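(* Let $(X,\omega_X),(Y,\omega_Y)$ be networks and let $k\ge 0$ be an integer. Then $$d_{\mathrm B}\bigl(\mathrm{Dgm}_k^{\mathfrak R}(X),\mathrm{Dgm}_k^{\mathfrak R}(Y)\bigr)\le 2\,d_{\mathcal N}(X,Y).$$
   Context: A network is a pair $(X,\omega_X)$ where $X$ is a finite (nonempty) set and $\omega_X:X\times X\to\mathbb R$ is any function. For $\delta\in\mathbb R$, the Rips complex is $\mathfrak R^\delta_X=\{\sigma\subseteq X,\ \sigma\neq\varnothing:\max_{x,x'\in\sigma}\omega_X(x,x')\le\delta\}$; these form a filtration under inclusion as $\delta$ increases. Fix a field $\mathbb K$. $\mathrm{Dgm}_k^{\mathfrak R}(X)$ is the persistence diagram of the persistence vector space $\{H_k(\mathfrak R^\delta_X;\mathbb K)\to H_k(\mathfrak R^{\delta'}_X;\mathbb K)\}_{\delta\le\delta'}$ with maps induced by inclusions; that is, the multiset of points $(a,b)\in\overline{\mathbb R}^2$ ($\overline{\mathbb R}=\mathbb R\cup\{\pm\infty\}$), one for each interval $[a,b)$ in its decomposition into interval modules. $d_{\mathrm B}$ is the bottleneck distance between persistence diagrams: the infimum over partial matchings of the two multisets (unmatched points being matched to the diagonal) of the largest $\ell^\infty$ displacement. A correspondence between $X$ and $Y$ is a relation $R\subseteq X\times Y$ whose projections to $X$ and to $Y$ are both surjective; its distortion is $\operatorname{dis}(R)=\max_{(x,y),(x',y')\in R}|\omega_X(x,x')-\omega_Y(y,y')|$. The network distance is $d_{\mathcal N}(X,Y)=\frac12\min_R\operatorname{dis}(R)$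 over all correspondences $R$. *)

theory Defs
  imports
    "HOL-Library.Extended_Real"
    "HOL-Library.Multiset"
    "HOL-Library.FuncSet"
    "HOL-Library.Function_Algebras"
    "HOL-Library.Set_Algebras"
begin

section \<open>Networks\<close>

text \<open>
  A network is a finite nonempty set \<open>X\<close> with a weight function \<open>w :: 'a \<Rightarrow> 'a \<Rightarrow> real\<close>;
  the values of \<open>w\<close> outside \<open>X \<times> X\<close> are never used.
\<close>

definition network :: "'a set \<Rightarrow> ('a \<Rightarrow> 'a \<Rightarrow> real) \<Rightarrow> bool"
  where "network X w \<longleftrightarrow> finite X \<and> X \<noteq> {}"

definition rips :: "'a set \<Rightarrow> ('a \<Rightarrow> 'a \<Rightarrow> real) \<Rightarrow> real \<Rightarrow> 'a set set"
  where "rips X w \<delta> =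
    {\<sigma>. \<sigma> \<subseteq> X \<and> \<sigma> \<noteq> {} \<and> Max ((\<lambda>(x, x'). w x x') ` (\<sigma> \<times> \<sigma>)) \<le> \<delta>}"

definition correspondence :: "'a set \<Rightarrow> 'b set \<Rightarrow> ('a \<times> 'b) set \<Rightarrow> bool"
  where "correspondence X Y R \<longleftrightarrow> R \<subseteq> X \<times> Y \<and> fst ` R = X \<and> snd ` R = Y"

definition distortion ::
    "('a \<Rightarrow> 'a \<Rightarrow> real) \<Rightarrow> ('b \<Rightarrow> 'b \<Rightarrow> real) \<Rightarrow> ('a \<times> 'b) set \<Rightarrow> real"
  where "distortion w w' R =
    Max ((\<lambda>((x, y), (x', y')). \<bar>w x x' - w' y y'\<bar>) ` (R \<times> R))"

definition network_dist ::
    "'a set \<Rightarrow> ('a \<Rightarrow> 'a \<Rightarrow> real) \<Rightarrow> 'b set \<Rightarrow> ('b \<Rightarrow> 'b \<Rightarrow> real) \<Rightarrow> real"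
  where "network_dist X w Y w' =
    1 / 2 * Min (distortion w w' ` {R. correspondence X Y R})"

section \<open>Simplicial homology of a finite complex with field coefficients\<close>

text \<open>
  A \<open>k\<close>-chain is a function on oriented \<open>k\<close>-simplices taking opposite values on opposite
  orientations.  An oriented simplex is given by an ordering of its vertices, and exchanging two
  vertices reverses the orientation, so a chain is an alternating function on vertex lists.
  Listing distinctness of the vertices separately makes this correct in characteristic 2 as well.
\<close>

definition chains :: "'a set set \<Rightarrow> nat \<Rightarrow> ('a list \<Rightarrow> 'k::field) set"
  where "chains S k =
    {c. (\<forall>xs. c xs \<noteq> 0 \<longrightarrow> distinct xs \<and> set xs \<in> S \<and> length xs = Suc k) \<and>
        (\<forall>xs i j. i < j \<and> j < length xs \<longrightarrow> c (xs[i := xs ! j, j := xs ! i]) = - c xs)}"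

text \<open>
  The value of \<open>\<partial>c\<close> at \<open>[y\<^sub>1,\<dots>,y\<^sub>k]\<close> is its coefficient there: the face opposite to \<open>v\<close> of
  \<open>[v, y\<^sub>1,\<dots>,y\<^sub>k]\<close> has incidence number \<open>+1\<close>.  The lemma \<open>boundary_face\<close> below is the usual
  formula \<open>\<partial>[x\<^sub>0,\<dots>,x\<^sub>k] = (\<Sum>i. (-1)^i [x\<^sub>0,\<dots>,x\<^sub>i\<^sub>-\<^sub>1,x\<^sub>i\<^sub>+\<^sub>1,\<dots>,x\<^sub>k])\<close>.
  The case of the empty list makes \<open>\<partial>\<close> vanish on 0-chains (homology is not reduced).
\<close>

definition boundary :: "'a set set \<Rightarrow> ('a list \<Rightarrow> 'k::field) \<Rightarrow> 'a list \<Rightarrow> 'k"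
  where "boundary S c ys = (if ys = [] then 0 else \<Sum>v\<in>\<Union>S. c (v # ys))"

lemma alternating_move:
  fixes c :: "'a list \<Rightarrow> 'k::field"
  assumes "\<And>xs i j. i < j \<Longrightarrow> j < length xs \<Longrightarrow> c (xs[i := xs ! j, j := xs ! i]) = - c xs"
  shows "c (x # us @ vs) = (-1) ^ length us * c (us @ x # vs)"
  using assms
proof (induction us arbitrary: c)
  case Nil
  then show ?case by simp
next
  case (Cons u us)
  have 1: "c (x # u # us @ vs) = - c (u # x # us @ vs)"
    using Cons.prems[of 0 1 "u # x # us @ vs"] by simp
  have 2: "c (u # x # us @ vs) = (-1) ^ length us * c (u # us @ x # vs)"
  proof (rule Cons.IH[of "\<lambda>ys. c (u # ys)"])
    fix xs :: "'a list" and i j :: nat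
    assume "i < j" "j < length xs"
    then show "c (u # xs[i := xs ! j, j := xs ! i]) = - c (u # xs)"
      using Cons.prems[of "Suc i" "Suc j" "u # xs"] by simp
  qed
  show ?case using 1 2 by simp
qed

lemma boundary_face:
  fixes c :: "'a list \<Rightarrow> 'k::field"
  assumes c: "c \<in> chains S k" and S: "finite (\<Union>S)"
    and xs: "distinct xs" "set xs \<in> S" "length xs \<ge> 2" and i: "i < length xs"
    and supp: "\<And>ys. set ys \<noteq> set xs \<Longrightarrow> c ys = 0"
  shows "boundary S c (take i xs @ drop (Suc i) xs) = (-1) ^ i * c xs"
proof -
  let ?ys = "take i xs @ drop (Suc i) xs"
  have split: "xs = take i xs @ xs ! i # drop (Suc i) xs"
    using i by (rule id_take_nth_drop)
  have ne: "?ys \<noteq> []" using xs(3) i by (auto simp: take_Cons')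
  have notin: "xs ! i \<notin> set ?ys"
    using arg_cong[OF split, of distinct] xs(1) by auto
  have zero: "c (v # ?ys) = 0" if "v \<noteq> xs ! i" for v
  proof (rule supp)
    have "xs ! i \<notin> set (v # ?ys)"
      unfolding list.set insert_iff using that notin by blast
    moreover have "xs ! i \<in> set xs"
      using i by (rule nth_mem)
    ultimately show "set (v # ?ys) \<noteq> set xs" by blast
  qed
  have "xs ! i \<in> \<Union>S" using xs(2) nth_mem[OF i] by blast
  then have "(\<Sum>v\<in>\<Union>S. c (v # ?ys)) = c (xs ! i # ?ys)"
    using S zero sum.remove[of "\<Union>S" "xs ! i" "\<lambda>v. c (v # ?ys)"]
      sum.neutral[of "\<Union>S - {xs ! i}" "\<lambda>v. c (v # ?ys)"] by simp
  also have "\<dots> = (-1) ^ length (take i xs) * c (take i xs @ xs ! i # drop (Suc i) xs)"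
    by (rule alternating_move) (use c in \<open>simp add: chains_def\<close>)
  also have "\<dots> = (-1) ^ i * c xs"
    using i by (simp add: id_take_nth_drop[symmetric])
  finally show ?thesis
    using ne unfolding boundary_def by (simp only: if_False)
qed

definition cycles :: "'a set set \<Rightarrow> nat \<Rightarrow> ('a list \<Rightarrow> 'k::field) set"
  where "cycles S k = {c \<in> chains S k. boundary S c = 0}"

definition boundaries :: "'a set set \<Rightarrow> nat \<Rightarrow> ('a list \<Rightarrow> 'k::field) set"
  where "boundaries S k = boundary S ` chains S (Suc k)"

text \<open>The quotient space of cycles modulo boundaries; its elements are cosets.\<close>

definition homology :: "'a set set \<Rightarrow> nat \<Rightarrow> ('a list \<Rightarrow> 'k::field) set set"
  where "homology S k = {z +o boundaries S k | z. z \<in> cycles S k}"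

section \<open>Persistence vector spaces and their diagrams\<close>

text \<open>
  A family of vector spaces indexed by the reals, with transition maps \<open>pv_map V s t\<close> from
  \<open>pv_space V s\<close> to \<open>pv_space V t\<close> for \<open>s \<le> t\<close>.
\<close>

record ('k, 'v) persistence_vs =
  pv_space :: "real \<Rightarrow> 'v set"
  pv_add :: "real \<Rightarrow> 'v \<Rightarrow> 'v \<Rightarrow> 'v"
  pv_smult :: "real \<Rightarrow> 'k \<Rightarrow> 'v \<Rightarrow> 'v"
  pv_map :: "real \<Rightarrow> real \<Rightarrow> 'v \<Rightarrow> 'v"

definition pv_isomorphic ::
    "('k::field, 'v) persistence_vs \<Rightarrow> ('k, 'w) persistence_vs \<Rightarrow> bool"
  where "pv_isomorphic V W \<longleftrightarrow> (\<exists>\<Phi> :: real \<Rightarrow> 'v \<Rightarrow> 'w.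
    (\<forall>t. bij_betw (\<Phi> t) (pv_space V t) (pv_space W t)) \<and>
    (\<forall>t. \<forall>x\<in>pv_space V t. \<forall>y\<in>pv_space V t.
      \<Phi> t (pv_add V t x y) = pv_add W t (\<Phi> t x) (\<Phi> t y)) \<and>
    (\<forall>t r. \<forall>x\<in>pv_space V t. \<Phi> t (pv_smult V t r x) = pv_smult W t r (\<Phi> t x)) \<and>
    (\<forall>s t. s \<le> t \<longrightarrow> (\<forall>x\<in>pv_space V s. \<Phi> t (pv_map V s t x) = pv_map W s t (\<Phi> s x))))"

definition in_interval :: "ereal \<times> ereal \<Rightarrow> real \<Rightarrow> bool"
  where "in_interval p t \<longleftrightarrow> fst p \<le> ereal t \<and> ereal t < snd p"

definition interval_module :: "ereal \<times> ereal \<Rightarrow> ('k::field, 'k) persistence_vs"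
  where "interval_module p = \<lparr>
    pv_space = (\<lambda>t. if in_interval p t then UNIV else {0}),
    pv_add = (\<lambda>t x y. x + y),
    pv_smult = (\<lambda>t r x. r * x),
    pv_map = (\<lambda>s t x. if in_interval p s \<and> in_interval p t then x else 0)\<rparr>"

definition direct_sum :: "('k::field, 'v) persistence_vs list \<Rightarrow> ('k, nat \<Rightarrow> 'v) persistence_vs"
  where "direct_sum Ms = \<lparr>
    pv_space = (\<lambda>t. \<Pi>\<^sub>E i\<in>{..<length Ms}. pv_space (Ms ! i) t),
    pv_add = (\<lambda>t x y. \<lambda>i\<in>{..<length Ms}. pv_add (Ms ! i) t (x i) (y i)),
    pv_smult = (\<lambda>t r x. \<lambda>i\<in>{..<length Ms}. pv_smult (Ms ! i) t r (x i)),
    pv_map = (\<lambda>s t x. \<lambda>i\<in>{..<length Ms}. pv_map (Ms ! i) s t (x i))\<rparr>"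

text \<open>
  The multiset is unique by the Krull-Remak-Schmidt-Azumaya theorem (intervals are required to be
  nonempty).  Only finite decompositions occur, since a finite complex has finite-dimensional
  homology and its filtrations have finitely many steps.
\<close>

definition diagram :: "('k::field, 'v) persistence_vs \<Rightarrow> (ereal \<times> ereal) multiset"
  where "diagram V = (THE D. \<exists>ps. mset ps = D \<and> (\<forall>p\<in>set ps. fst p < snd p) \<and>
    pv_isomorphic V (direct_sum (map interval_module ps)))"

text \<open>
  \<open>A + A'\<close> is the elementwise sum of sets, which is the sum of cosets; adding the subspace of
  boundaries turns \<open>r z\<close> (also for \<open>r = 0\<close>), respectively a coset of the smaller space of
  boundaries, into the required coset.  So \<open>pv_map\<close> is the map induced by the inclusion.
\<close>

definition persistent_homology ::
    "(real \<Rightarrow> 'a set set) \<Rightarrow> nat \<Rightarrow> ('k::field, ('a list \<Rightarrow> 'k) set) persistence_vs"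
  where "persistent_homology F k = \<lparr>
    pv_space = (\<lambda>t. homology (F t) k),
    pv_add = (\<lambda>t A A'. A + A'),
    pv_smult = (\<lambda>t r A. (\<lambda>z xs. r * z xs) ` A + boundaries (F t) k),
    pv_map = (\<lambda>s t A. A + boundaries (F t) k)\<rparr>"

definition rips_diagram ::
    "'k::field itself \<Rightarrow> nat \<Rightarrow> 'a set \<Rightarrow> ('a \<Rightarrow> 'a \<Rightarrow> real) \<Rightarrow> (ereal \<times> ereal) multiset"
  where "rips_diagram _ k X w =
    diagram (persistent_homology (rips X w) k :: ('k, ('a list \<Rightarrow> 'k) set) persistence_vs)"

section \<open>Bottleneck distance\<close>

text \<open>The case distinction is needed because \<open>\<infinity> - \<infinity> = \<infinity>\<close> in \<open>ereal\<close>.\<close>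

definition ext_dist :: "ereal \<Rightarrow> ereal \<Rightarrow> ereal"
  where "ext_dist a b = (if a = b then 0 else \<bar>a - b\<bar>)"

definition linf_dist :: "ereal \<times> ereal \<Rightarrow> ereal \<times> ereal \<Rightarrow> ereal"
  where "linf_dist p q = max (ext_dist (fst p) (fst q)) (ext_dist (snd p) (snd q))"

definition diag_dist :: "ereal \<times> ereal \<Rightarrow> ereal"
  where "diag_dist p = (INF c. linf_dist p (c, c))"

lemma diag_dist_real:
  assumes "a \<le> b"
  shows "diag_dist (ereal a, ereal b) = ereal ((b - a) / 2)"
  unfolding diag_dist_def
proof (rule antisym)
  have "linf_dist (ereal a, ereal b) (ereal ((a + b) / 2), ereal ((a + b) / 2))
      = max \<bar>ereal a - ereal ((a + b) / 2)\<bar> \<bar>ereal b - ereal ((a + b) / 2)\<bar>"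
    by (simp add: linf_dist_def ext_dist_def)
  also have "\<dots> = ereal (max \<bar>a - (a + b) / 2\<bar> \<bar>b - (a + b) / 2\<bar>)"
    by (simp add: ereal_max)
  also have "max \<bar>a - (a + b) / 2\<bar> \<bar>b - (a + b) / 2\<bar> = (b - a) / 2"
  proof -
    have "a - (a + b) / 2 = - ((b - a) / 2)" by argo
    moreover have "b - (a + b) / 2 = (b - a) / 2" by argo
    ultimately show ?thesis using assms by simp
  qed
  finally show "(INF c. linf_dist (ereal a, ereal b) (c, c)) \<le> ereal ((b - a) / 2)"
    using INF_lower[of "ereal ((a + b) / 2)" UNIV "\<lambda>c. linf_dist (ereal a, ereal b) (c, c)"]
    by (simp only: UNIV_I simp_thms)
  show "ereal ((b - a) / 2) \<le> (INF c. linf_dist (ereal a, ereal b) (c, c))"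
  proof (rule INF_greatest)
    fix c :: ereal
    show "ereal ((b - a) / 2) \<le> linf_dist (ereal a, ereal b) (c, c)"
    proof (cases c)
      case (real r)
      have "(b - a) / 2 \<le> max \<bar>a - r\<bar> \<bar>b - r\<bar>" proof -
        have "b - a \<le> \<bar>a - r\<bar> + \<bar>b - r\<bar>" by arith
        then show ?thesis 
          by (cases "\<bar>a - r\<bar> \<le> \<bar>b - r\<bar>") (simp_all only: max_def if_True if_False, argo+)
      qed
      also have "ereal (max \<bar>a - r\<bar> \<bar>b - r\<bar>) = linf_dist (ereal a, ereal b) (c, c)"
        using real by (simp add: linf_dist_def ext_dist_def ereal_max)
      finally show ?thesis by simp
    qed (simp_all add: linf_dist_def ext_dist_def)
  qed
qed

lemma diag_dist_infinity: "diag_dist (ereal a, \<infinity>) = \<infinity>"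
proof -
  have "linf_dist (ereal a, \<infinity>) (c, c) = \<infinity>" for c
    by (cases c) (auto simp: linf_dist_def ext_dist_def)
  then show ?thesis by (simp add: diag_dist_def)
qed

definition partial_matching :: "'p multiset \<Rightarrow> 'q multiset \<Rightarrow> ('p \<times> 'q) multiset \<Rightarrow> bool"
  where "partial_matching A B M \<longleftrightarrow> image_mset fst M \<subseteq># A \<and> image_mset snd M \<subseteq># B"

definition matching_cost ::
    "(ereal \<times> ereal) multiset \<Rightarrow> (ereal \<times> ereal) multiset \<Rightarrow>
      ((ereal \<times> ereal) \<times> (ereal \<times> ereal)) multiset \<Rightarrow> ereal"
  where "matching_cost A B M = Sup (insert 0
    ((\<lambda>(p, q). linf_dist p q) ` set_mset M \<union>
     diag_dist ` set_mset (A - image_mset fst M) \<union>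
     diag_dist ` set_mset (B - image_mset snd M)))"

definition bottleneck_dist ::
    "(ereal \<times> ereal) multiset \<Rightarrow> (ereal \<times> ereal) multiset \<Rightarrow> ereal"
  where "bottleneck_dist A B = (INF M\<in>{M. partial_matching A B M}. matching_cost A B M)"

end

theory Submission imports Defs
begin

text \<open>
  A correspondence \<open>R\<close> carries two weight functions, pulled back from \<open>X\<close> and from \<open>Y\<close>, which differ by
  at most its distortion. A vertex of \<open>R\<close> with the same image in \<open>X\<close> as another one is dominated by it,
  so vertices can be pushed onto a section without changing persistent homology: the pullbacks have
  the diagrams of \<open>X\<close> and \<open>Y\<close>, and only two weights on one vertex set have to be compared. If no two
  pairs of vertices are ordered oppositely by the weights, all Rips complexes of both weights form one
  chain under inclusion, so the flags of cycles and of boundaries have a common adapted basis.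
  Each basis element gives one point in either diagram (a possibly diagonal one), and
  these two points are as close as the weights. The general case follows by cutting the
  segment between the two weights at the finitely many parameters where the order changes.
\<close>

section \<open>Common adapted bases of two flags\<close>

text \<open>Two flags in a vector space always admit a common adapted basis; three need not, as
  three distinct lines through the origin of a plane show. One filtration has two flags, its cycles
  and its boundaries, but two filtrations bring four. They share a basis once the cycles of both
  form a single flag and the boundaries of both form another; excluding inverted pairs achieves
  this, and ties between weights are harmless. Cutting the segment costs nothing in the constant:
  the bounds t\<epsilon> and (1 - t)\<epsilon> of the two pieces add up to \<epsilon>, and closeness
  of diagrams composes additively. Since \<open>diagram\<close> is a definite description, computing
  it requires both an interval decomposition, read off from the adapted basis, and its uniqueness,
  obtained from the ranks of the transition maps. What is bounded in the end is the distortion of an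
  optimal correspondence, so the factor 2 just undoes the 1/2 in
  \<open>network_dist\<close>.\<close>

lemma Union_in_finite_chain:
  assumes "finite C" "C \<noteq> {}" "chain_subset C"
  shows "\<Union>C \<in> C"
proof -
  obtain X where "X \<in> C" "\<And>Y. Y \<in> C \<Longrightarrow> X \<subseteq> Y \<Longrightarrow> X = Y"
    using finite_has_maximal[OF assms(1,2)] by metis
  then have "\<Union>C = X" using assms(3) unfolding chain_subset_def by blast
  then show ?thesis using \<open>X \<in> C\<close> by simp
qed

text \<open>A nonempty finite chain contains its union. Splitting off this top member lets the chain
  grow from the bottom up, with \<open>\<Union>C\<close> as the previous top.\<close>

lemma finite_chain_induct [consumes 2, case_names empty insert]:
  assumes "finite C" and "chain_subset C"
    and "P {}"
    and "\<And>X C. finite C \<Longrightarrow> (\<And>Y. Y \<in> C \<Longrightarrow> Y \<subseteq> X) \<Longrightarrow>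
      (C \<noteq> {} \<Longrightarrow> \<Union>C \<in> C) \<Longrightarrow> P C \<Longrightarrow> P (insert X C)"
  shows "P C"
  using assms(1,2)
proof (induction "card C" arbitrary: C)
  case 0
  then show ?case using assms(3) by simp
next
  case (Suc n)
  then have "C \<noteq> {}" by auto
  define X where "X = \<Union>C"
  have X: "X \<in> C" and top: "\<And>Y. Y \<in> C \<Longrightarrow> Y \<subseteq> X"
    using Union_in_finite_chain[of C] Suc.prems \<open>C \<noteq> {}\<close> unfolding X_def by blast+
  have chain: "chain_subset (C - {X})"
    using Suc.prems(2) unfolding chain_subset_def by blast
  have "P (C - {X})"
    using Suc.prems Suc.hyps(2) X(1) chain by (intro Suc.hyps(1)) auto
  then have "P (insert X (C - {X}))"
    using Suc.prems chain top by (intro assms(4) Union_in_finite_chain) auto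
  then show ?case using X(1) by (simp add: insert_absorb)
qed

context vector_space
begin

text \<open>A maximal independent set \<open>F\<close> between \<open>E\<close> and
  \<open>E \<union> U\<close> works. Its elements outside \<open>U\<close> all come from
  \<open>E\<close>, so the part of a vector of \<open>U\<close> that they carry lies in
  \<open>span E \<inter> U\<close>, where the hypothesis applies.\<close>

lemma independent_extend_adapted:
  assumes "independent E" "subspace U" "span E \<inter> U \<subseteq> span (E \<inter> U)"
  obtains F where "E \<subseteq> F" "F \<subseteq> E \<union> U" "independent F" "U \<subseteq> span (F \<inter> U)"
proof -
  obtain F where F: "E \<subseteq> F" "F \<subseteq> E \<union> U" "independent F" "E \<union> U \<subseteq> span F"
    using maximal_independent_subset_extend[of E "E \<union> U"] assms(1) by auto
  have "x \<in> span (F \<inter> U)" if x: "x \<in> U" for x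
  proof -
    have "F = (F - U) \<union> (F \<inter> U)" by blast
    then obtain y z where yz: "x = y + z" "y \<in> span (F - U)" "z \<in> span (F \<inter> U)"
      using F(4) x span_Un[of "F - U" "F \<inter> U"] by auto
    have "z \<in> U"
      using yz(3) span_minimal[OF _ assms(2), of "F \<inter> U"] by blast
    then have "y \<in> U"
      using yz(1) x subspace_diff[OF assms(2), of x z] by simp
    moreover have "y \<in> span E"
      using yz(2) F(2) span_mono[of "F - U" E] by blast
    ultimately have "y \<in> span (F \<inter> U)"
      using assms(3) F(1) span_mono[of "E \<inter> U" "F \<inter> U"] by blast
    then show ?thesis using yz span_add by blast
  qed
  then show ?thesis using that F by blast
qed

text \<open>The members are treated from the bottom up. The condition on \<open>E\<close> passes to
  the current \<open>F\<close>, because whatever \<open>F\<close> has beyond \<open>E\<close> lies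
  in smaller members and hence in the next \<open>U\<close>.\<close>

lemma independent_extend_adapted_chain:
  assumes "finite \<U>" "chain_subset \<U>"
    and "\<And>U. U \<in> \<U> \<Longrightarrow> subspace U"
    and "independent E" "\<And>U. U \<in> \<U> \<Longrightarrow> span E \<inter> U \<subseteq> span (E \<inter> U)"
  shows "\<exists>F. E \<subseteq> F \<and> F \<subseteq> E \<union> \<Union>\<U> \<and> independent F \<and> (\<forall>U\<in>\<U>. U \<subseteq> span (F \<inter> U))"
  using assms(1,2,3,5)
proof (induction rule: finite_chain_induct)
  case empty
  then show ?case using assms(4) by auto
next
  case (insert U \<U>)
  then obtain F where F: "E \<subseteq> F" "F \<subseteq> E \<union> \<Union>\<U>" "independent F" "\<And>V. V \<in> \<U> \<Longrightarrow> V \<subseteq> span (F \<inter> V)"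
    by (metis insertCI)
  have U: "subspace U" using insert.prems by blast
  have "x \<in> span (F \<inter> U)" if x: "x \<in> span F" "x \<in> U" for x
  proof -
    have "F \<subseteq> E \<union> (F \<inter> U)" using F(2) insert.hyps by blast
    then have "x \<in> span (E \<union> (F \<inter> U))" using x(1) span_mono by blast
    then obtain y z where yz: "x = y + z" "y \<in> span E" "z \<in> span (F \<inter> U)"
      unfolding span_Un by blast
    have "z \<in> U"
      using yz(3) span_minimal[OF _ U, of "F \<inter> U"] by blast
    then have "y \<in> U"
      using yz(1) x subspace_diff[OF U, of x z] by simp
    then have "y \<in> span (F \<inter> U)"
      using insert.prems(2)[of U] yz(2) F(1) span_mono[of "E \<inter> U" "F \<inter> U"] by blast
    then show ?thesis using yz span_add by blast
  qed
  then have "span F \<inter> U \<subseteq> span (F \<inter> U)" by blast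
  then obtain G where G: "F \<subseteq> G" "G \<subseteq> F \<union> U" "independent G" "U \<subseteq> span (G \<inter> U)"
    using independent_extend_adapted[OF F(3) U] by blast
  have "V \<subseteq> span (G \<inter> V)" if "V \<in> \<U>" for V
    using F(4)[OF that] G(1) span_mono[of "F \<inter> V" "G \<inter> V"] by blast
  then show ?case using F(1,2) G by (intro exI[of _ G]) auto
qed

text \<open>When a new top \<open>A\<close> is added, the spaces \<open>A \<inter> B\<close> form a
  chain, along which the set built so far is extended. The extension condition holds because
  \<open>span E\<close> stays inside the previous top \<open>\<Union>\<A>\<close>, and
  \<open>E\<close> is already adapted to \<open>\<Union>\<A> \<inter> B\<close>.\<close>

lemma common_adapted_independent:
  assumes "finite \<A>" "chain_subset \<A>"
    and "\<And>A. A \<in> \<A> \<Longrightarrow> subspace A"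
    and "finite \<B>" "chain_subset \<B>"
    and "\<And>B. B \<in> \<B> \<Longrightarrow> subspace B"
  shows "\<exists>E. independent E \<and> E \<subseteq> \<Union>\<A> \<and> (\<forall>A\<in>\<A>. \<forall>B\<in>\<B>. A \<inter> B \<subseteq> span (E \<inter> A \<inter> B))"
  using assms(1-3)
proof (induction rule: finite_chain_induct)
  case empty
  then show ?case using independent_empty by auto
next
  case (insert A \<A>)
  then obtain E where E: "independent E" "E \<subseteq> \<Union>\<A>"
    "\<And>A B. A \<in> \<A> \<Longrightarrow> B \<in> \<B> \<Longrightarrow> A \<inter> B \<subseteq> span (E \<inter> A \<inter> B)"
    by (metis insertCI)
  have A: "subspace A" using insert.prems by blast
  have adapted: "span E \<inter> U \<subseteq> span (E \<inter> U)" if U: "U \<in> (\<inter>) A ` \<B>" for U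
  proof -
    obtain B where B: "B \<in> \<B>" "U = A \<inter> B" using U by blast
    have sU: "subspace U" using B A assms(6) subspace_inter by blast
    show ?thesis
    proof (cases "\<A> = {}")
      case True
      then have "span E = {0}" using E(2) by simp
      then show ?thesis using span_zero by auto
    next
      case False
      have "\<Union>\<A> \<in> \<A>"
        using insert.hyps(3) False by blast
      then have "span E \<subseteq> \<Union>\<A>"
        using E(2) span_minimal insert.prems by blast
      then have "span E \<inter> U \<subseteq> \<Union>\<A> \<inter> B" using B by blast
      also have "\<dots> \<subseteq> span (E \<inter> \<Union>\<A> \<inter> B)"
        using E(3)[OF \<open>\<Union>\<A> \<in> \<A>\<close> B(1)] .
      also have "\<dots> \<subseteq> span (E \<inter> U)"
        using B insert.hyps by (intro span_mono) blast
      finally show ?thesis .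
    qed
  qed
  have "\<exists>F. E \<subseteq> F \<and> F \<subseteq> E \<union> \<Union>((\<inter>) A ` \<B>) \<and> independent F \<and> (\<forall>U\<in>(\<inter>) A ` \<B>. U \<subseteq> span (F \<inter> U))"
  proof (rule independent_extend_adapted_chain[OF _ _ _ E(1) adapted])
    show "finite ((\<inter>) A ` \<B>)" using assms(4) by simp
    show "chain_subset ((\<inter>) A ` \<B>)"
      using assms(5) unfolding chain_subset_def by blast
    show "subspace U" if "U \<in> (\<inter>) A ` \<B>" for U
      using that A assms(6) subspace_inter by blast
  qed
  then obtain F where F: "E \<subseteq> F" "F \<subseteq> E \<union> \<Union>((\<inter>) A ` \<B>)" "independent F"
      "\<And>B. B \<in> \<B> \<Longrightarrow> A \<inter> B \<subseteq> span (F \<inter> (A \<inter> B))"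
    by auto
  have "A' \<inter> B \<subseteq> span (F \<inter> A' \<inter> B)" if "A' \<in> insert A \<A>" "B \<in> \<B>" for A' B
  proof (cases "A' = A")
    case True
    then show ?thesis using F(4)[OF that(2)] by (simp add: Int_assoc)
  next
    case False
    then have "A' \<inter> B \<subseteq> span (E \<inter> A' \<inter> B)" using E(3) that by blast
    also have "\<dots> \<subseteq> span (F \<inter> A' \<inter> B)" using F(1) by (intro span_mono) blast
    finally show ?thesis .
  qed
  moreover have "F \<subseteq> \<Union>(insert A \<A>)"
    using F(2) E(2) by blast
  ultimately show ?case using F(3) by blast
qed

end

section \<open>Interval multisets\<close>

text \<open>Both \<open>A + (B - A)\<close> and \<open>B + (A - B)\<close> have the larger of the
  two multiplicities everywhere. Writing sums avoids truncated subtraction.\<close>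

lemma size_filter_diff_cancel:
  fixes A B :: "'p multiset"
  shows "size (filter_mset P A) + size (filter_mset P (B - A)) =
    size (filter_mset P B) + size (filter_mset P (A - B))"
proof -
  have "A + (B - A) = B + (A - B)"
    by (rule multiset_eqI) simp
  then have "filter_mset P (A + (B - A)) = filter_mset P (B + (A - B))"
    by simp
  then show ?thesis
    by (metis filter_union_mset size_union)
qed

text \<open>
  Among the points of both multisets, take one with the least birth and, among these, the greatest
  death: some \<open>s \<le> t\<close> separate it from all the other points.
\<close>

lemma exists_isolating_parameters:
  fixes C :: "(ereal \<times> ereal) set"
  assumes "finite C" "C \<noteq> {}" "\<And>p. p \<in> C \<Longrightarrow> fst p < snd p"
  obtains p s t where "p \<in> C" "s \<le> t"
    "\<And>q. q \<in> C \<Longrightarrow> fst q \<le> ereal s \<and> ereal t < snd q \<longleftrightarrow> q = p"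
proof -
  define a where "a = Min (fst ` C)"
  have a: "a \<in> fst ` C" "\<And>q. q \<in> C \<Longrightarrow> a \<le> fst q"
    using assms(1,2) unfolding a_def by auto
  define b where "b = Max (snd ` {q\<in>C. fst q = a})"
  have ne: "snd ` {q\<in>C. fst q = a} \<noteq> {}" "finite (snd ` {q\<in>C. fst q = a})"
    using a(1) assms(1) by auto
  have "b \<in> snd ` {q\<in>C. fst q = a}" unfolding b_def using ne by (intro Max_in)
  then have p: "(a, b) \<in> C" by force
  have b: "snd q \<le> b" if "q \<in> C" "fst q = a" for q
    unfolding b_def using ne that by (intro Max_ge) auto
  have ab: "a < b" using assms(3)[OF p] by simp
  \<comment> \<open>The next birth after \<open>a\<close>, capped by \<open>b\<close>: a real
    \<open>s\<close> with \<open>a \<le> ereal s < c\<close> excludes all points born after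
    \<open>a\<close>. As \<open>a\<close> may be \<open>-\<infinity>\<close>, it cannot itself serve
    as \<open>s\<close>.\<close>
  define c where "c = Min (insert b (fst ` {q\<in>C. a < fst q}))"
  have fin: "finite (insert b (fst ` {q\<in>C. a < fst q}))" using assms(1) by simp
  have "c \<in> insert b (fst ` {q\<in>C. a < fst q})"
    unfolding c_def by (rule Min_in) (use fin in auto)
  then have ac: "a < c" using ab by auto
  have cb: "c \<le> b" unfolding c_def by (rule Min_le) (use fin in auto)
  have cq: "c \<le> fst q" if "q \<in> C" "a < fst q" for q
    unfolding c_def by (rule Min_le) (use fin that in auto)
  obtain s where s: "a \<le> ereal s" "ereal s < c"
  proof (cases a)
    case (real r)
    then show ?thesis using that[of r] ac by simp
  next
    case PInf
    then show ?thesis using ac by simp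
  next
    case MInf
    then show ?thesis using that ac ereal_dense2[of a c] by auto
  qed
  \<comment> \<open>The last death before \<open>b\<close> among the points born at
    \<open>a\<close>, but at least \<open>s\<close>. It is finite since
    \<open>ereal s \<le> m < b\<close>, so it can serve as \<open>t\<close>.\<close>
  define m where "m = Max (insert (ereal s) (snd ` {q\<in>C. fst q = a \<and> snd q < b}))"
  have fin': "finite (insert (ereal s) (snd ` {q\<in>C. fst q = a \<and> snd q < b}))"
    using assms(1) by simp
  have "m \<in> insert (ereal s) (snd ` {q\<in>C. fst q = a \<and> snd q < b})"
    unfolding m_def by (rule Max_in) (use fin' in auto)
  then have mb: "m < b" using s(2) cb by auto
  have sm: "ereal s \<le> m" unfolding m_def by (rule Max_ge) (use fin' in auto)
  have mq: "snd q \<le> m" if "q \<in> C" "fst q = a" "snd q < b" for q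
    unfolding m_def by (rule Max_ge) (use fin' that in auto)
  obtain t where t: "m = ereal t"
    using mb sm by (cases m) auto
  show ?thesis
  proof (rule that[OF p])
    show "s \<le> t" using sm t by simp
    fix q assume q: "q \<in> C"
    show "fst q \<le> ereal s \<and> ereal t < snd q \<longleftrightarrow> q = (a, b)"
    proof
      assume *: "fst q \<le> ereal s \<and> ereal t < snd q"
      then have "fst q = a" using a(2)[OF q] cq[OF q] s(2) by fastforce
      moreover from this have "snd q = b" using mq[OF q] b[OF q] t * by fastforce
      ultimately show "q = (a, b)" by (simp add: prod_eq_iff)
    next
      assume "q = (a, b)"
      then show "fst q \<le> ereal s \<and> ereal t < snd q" using s mb t by simp
    qed
  qed
qed

text \<open>If the multisets differ, some point of \<open>A - B\<close> or \<open>B - A\<close> can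
  be isolated by parameters \<open>s \<le> t\<close>. Equality of ranks then gives it the same
  multiplicity in \<open>A - B\<close> and in \<open>B - A\<close>; as one of these is zero, so is
  the other.\<close>

lemma interval_multiset_eqI:
  fixes A B :: "(ereal \<times> ereal) multiset"
  assumes "\<And>p. p \<in># A \<Longrightarrow> fst p < snd p" "\<And>p. p \<in># B \<Longrightarrow> fst p < snd p"
    and rank: "\<And>s t. s \<le> t \<Longrightarrow>
      size {#p \<in># A. fst p \<le> ereal s \<and> ereal t < snd p#} =
      size {#p \<in># B. fst p \<le> ereal s \<and> ereal t < snd p#}"
  shows "A = B"
proof -
  define C where "C = set_mset (A - B) \<union> set_mset (B - A)"
  have "C = {}"
  proof (rule ccontr)
    assume "C \<noteq> {}"
    moreover have "finite C" by (simp add: C_def)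
    moreover have "fst p < snd p" if "p \<in> C" for p
      using that assms(1,2) in_diffD unfolding C_def by (metis Un_iff)
    ultimately obtain p s t where p: "p \<in> C" "s \<le> t"
      "\<And>q. q \<in> C \<Longrightarrow> fst q \<le> ereal s \<and> ereal t < snd q \<longleftrightarrow> q = p"
      using exists_isolating_parameters by metis
    have "{#q \<in># A - B. fst q \<le> ereal s \<and> ereal t < snd q#} = {#q \<in># A - B. q = p#}"
      using p(3) by (intro filter_mset_cong) (auto simp: C_def)
    moreover have "{#q \<in># B - A. fst q \<le> ereal s \<and> ereal t < snd q#} = {#q \<in># B - A. q = p#}"
      using p(3) by (intro filter_mset_cong) (auto simp: C_def)
    ultimately have "count (A - B) p = count (B - A) p"
      using size_filter_diff_cancel[of "\<lambda>q. fst q \<le> ereal s \<and> ereal t < snd q" A B]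
        rank[OF p(2)] by (simp add: filter_eq_replicate_mset)
    then have "count (A - B) p = 0 \<and> count (B - A) p = 0" by auto
    then show False using p(1) unfolding C_def by (auto simp flip: count_greater_zero_iff)
  qed
  then show "A = B"
    unfolding C_def by (metis Diff_eq_empty_iff_mset Un_empty set_mset_eq_empty_iff subset_mset.antisym)
qed

section \<open>Spaces of functions\<close>

abbreviation (input) fscale :: "'k \<Rightarrow> ('i \<Rightarrow> 'k) \<Rightarrow> 'i \<Rightarrow> 'k::field"
  where "fscale r z \<equiv> (\<lambda>i. r * z i)"

interpretation fs: vector_space "fscale :: 'k \<Rightarrow> ('i \<Rightarrow> 'k) \<Rightarrow> 'i \<Rightarrow> 'k::field"
  by unfold_locales (auto simp: fun_eq_iff algebra_simps)

definition unit_fun :: "'i \<Rightarrow> 'i \<Rightarrow> 'k::field"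
  where "unit_fun i = (\<lambda>j. if j = i then 1 else 0)"

lemma sum_unit_fun:
  assumes "finite S"
  shows "(\<Sum>j\<in>S. fscale (u j) (unit_fun j)) i = (if i \<in> S then u i else 0)"
  using assms by (induction S) (auto simp: unit_fun_def)

lemma in_span_unit_fun:
  assumes "finite S" "\<And>i. i \<notin> S \<Longrightarrow> f i = 0"
  shows "f \<in> fs.span (unit_fun ` S)"
proof -
  have "f = (\<Sum>j\<in>S. fscale (f j) (unit_fun j))"
    using assms by (intro ext) (simp only: sum_unit_fun, simp)
  also have "\<dots> \<in> fs.span (unit_fun ` S)"
    by (intro fs.span_sum fs.span_scale fs.span_base) simp
  finally show ?thesis .
qed

lemma inj_unit_fun: "inj (unit_fun :: 'i \<Rightarrow> 'i \<Rightarrow> 'k::field)"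
  by (rule injI) (metis unit_fun_def zero_neq_one)

lemma independent_unit_fun:
  assumes "finite S"
  shows "fs.independent (unit_fun ` S :: ('i \<Rightarrow> 'k::field) set)"
proof (rule fs.independent_if_scalars_zero)
  show "finite (unit_fun ` S :: ('i \<Rightarrow> 'k) set)" using assms by simp
  fix f :: "('i \<Rightarrow> 'k) \<Rightarrow> 'k" and x
  assume 0: "(\<Sum>x\<in>unit_fun ` S. fscale (f x) x) = 0" and "x \<in> (unit_fun ` S :: ('i \<Rightarrow> 'k) set)"
  then obtain i where i: "i \<in> S" "x = unit_fun i" by blast
  have "(\<Sum>j\<in>S. fscale (f (unit_fun j)) (unit_fun j)) = 0"
    using 0 by (subst (asm) sum.reindex) (auto intro: inj_on_subset[OF inj_unit_fun])
  then show "f x = 0"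
    using sum_unit_fun[OF assms, of "\<lambda>j. f (unit_fun j)" i] i by simp
qed

section \<open>Persistence modules\<close>

lemma pv_isomorphic_trans:
  assumes "pv_isomorphic U V" "pv_isomorphic V W"
  shows "pv_isomorphic U W"
proof -
  obtain \<Phi> where \<Phi>: "\<And>t. bij_betw (\<Phi> t) (pv_space U t) (pv_space V t)"
    "\<And>t x y. x \<in> pv_space U t \<Longrightarrow> y \<in> pv_space U t \<Longrightarrow> \<Phi> t (pv_add U t x y) = pv_add V t (\<Phi> t x) (\<Phi> t y)"
    "\<And>t r x. x \<in> pv_space U t \<Longrightarrow> \<Phi> t (pv_smult U t r x) = pv_smult V t r (\<Phi> t x)"
    "\<And>s t x. s \<le> t \<Longrightarrow> x \<in> pv_space U s \<Longrightarrow> \<Phi> t (pv_map U s t x) = pv_map V s t (\<Phi> s x)"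
    using assms(1) unfolding pv_isomorphic_def by metis
  obtain \<Psi> where \<Psi>: "\<And>t. bij_betw (\<Psi> t) (pv_space V t) (pv_space W t)"
    "\<And>t x y. x \<in> pv_space V t \<Longrightarrow> y \<in> pv_space V t \<Longrightarrow> \<Psi> t (pv_add V t x y) = pv_add W t (\<Psi> t x) (\<Psi> t y)"
    "\<And>t r x. x \<in> pv_space V t \<Longrightarrow> \<Psi> t (pv_smult V t r x) = pv_smult W t r (\<Psi> t x)"
    "\<And>s t x. s \<le> t \<Longrightarrow> x \<in> pv_space V s \<Longrightarrow> \<Psi> t (pv_map V s t x) = pv_map W s t (\<Psi> s x)"
    using assms(2) unfolding pv_isomorphic_def by metis
  have "\<Phi> t x \<in> pv_space V t" if "x \<in> pv_space U t" for t x
    using \<Phi>(1) that bij_betwE by blast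
  then show ?thesis
    unfolding pv_isomorphic_def
    by (intro exI[of _ "\<lambda>t. \<Psi> t \<circ> \<Phi> t"]) (auto simp: \<Phi> \<Psi> intro: bij_betw_trans[OF \<Phi>(1) \<Psi>(1)])
qed

text \<open>The record \<open>persistence_vs\<close> carries no axioms. An isomorphism can be
  inverted once the operations of its source are known to stay inside the source spaces.\<close>

definition pv_closed :: "('k::field, 'v) persistence_vs \<Rightarrow> bool"
  where "pv_closed V \<longleftrightarrow>
    (\<forall>t. \<forall>x\<in>pv_space V t. \<forall>y\<in>pv_space V t. pv_add V t x y \<in> pv_space V t) \<and>
    (\<forall>t r. \<forall>x\<in>pv_space V t. pv_smult V t r x \<in> pv_space V t) \<and>
    (\<forall>s t. s \<le> t \<longrightarrow> (\<forall>x\<in>pv_space V s. pv_map V s t x \<in> pv_space V t))"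

lemma pv_isomorphic_sym:
  assumes "pv_isomorphic V W" "pv_closed V"
  shows "pv_isomorphic W V"
proof -
  obtain \<Phi> where \<Phi>: "\<And>t. bij_betw (\<Phi> t) (pv_space V t) (pv_space W t)"
    "\<And>t x y. x \<in> pv_space V t \<Longrightarrow> y \<in> pv_space V t \<Longrightarrow> \<Phi> t (pv_add V t x y) = pv_add W t (\<Phi> t x) (\<Phi> t y)"
    "\<And>t r x. x \<in> pv_space V t \<Longrightarrow> \<Phi> t (pv_smult V t r x) = pv_smult W t r (\<Phi> t x)"
    "\<And>s t x. s \<le> t \<Longrightarrow> x \<in> pv_space V s \<Longrightarrow> \<Phi> t (pv_map V s t x) = pv_map W s t (\<Phi> s x)"
    using assms(1) unfolding pv_isomorphic_def by metis
  define \<Psi> where "\<Psi> t = inv_into (pv_space V t) (\<Phi> t)" for t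
  have inv: "\<Psi> t (\<Phi> t x) = x" if "x \<in> pv_space V t" for t x
    unfolding \<Psi>_def by (rule bij_betw_inv_into_left[OF \<Phi>(1) that])
  have W: "pv_space W t = \<Phi> t ` pv_space V t" for t
    using \<Phi>(1) by (simp add: bij_betw_def)
  have bij: "bij_betw (\<Psi> t) (pv_space W t) (pv_space V t)" for t
    using \<Phi>(1) unfolding \<Psi>_def by (rule bij_betw_inv_into)
  show ?thesis
    unfolding pv_isomorphic_def
  proof (intro exI[of _ \<Psi>] conjI allI impI)
    show "bij_betw (\<Psi> t) (pv_space W t) (pv_space V t)" for t by (rule bij)
    show "\<forall>x\<in>pv_space W t. \<forall>y\<in>pv_space W t. \<Psi> t (pv_add W t x y) = pv_add V t (\<Psi> t x) (\<Psi> t y)" for t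
      using assms(2) unfolding W pv_closed_def by (simp flip: \<Phi>(2) add: inv)
    show "\<forall>x\<in>pv_space W t. \<Psi> t (pv_smult W t r x) = pv_smult V t r (\<Psi> t x)" for t r
      using assms(2) unfolding W pv_closed_def by (simp flip: \<Phi>(3) add: inv)
    show "\<forall>x\<in>pv_space W s. \<Psi> t (pv_map W s t x) = pv_map V s t (\<Psi> s x)" if "s \<le> t" for s t
      using assms(2) that unfolding W pv_closed_def by (simp flip: \<Phi>(4) add: inv)
  qed
qed

section \<open>Uniqueness of interval decompositions\<close>

text \<open>The summands alive at both \<open>s\<close> and \<open>t\<close> span the image of the
  transition map. An isomorphism commutes with transition maps, so it sends this image injectively
  into the corresponding image on the other side, and dimensions can be compared.\<close>

lemma rank_le_of_isomorphic:
  fixes ps qs :: "(ereal \<times> ereal) list"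
  assumes iso: "pv_isomorphic (direct_sum (map interval_module ps) :: ('k::field, nat \<Rightarrow> 'k) persistence_vs)
      (direct_sum (map interval_module qs) :: ('k, nat \<Rightarrow> 'k) persistence_vs)"
    and st: "s \<le> t"
  shows "card {i. i < length ps \<and> in_interval (ps ! i) s \<and> in_interval (ps ! i) t} \<le>
    card {i. i < length qs \<and> in_interval (qs ! i) s \<and> in_interval (qs ! i) t}"
    (is "card ?S \<le> card ?S'")
proof -
  let ?V = "direct_sum (map interval_module ps) :: ('k, nat \<Rightarrow> 'k) persistence_vs"
  let ?W = "direct_sum (map interval_module qs) :: ('k, nat \<Rightarrow> 'k) persistence_vs"
  obtain \<Phi> where \<Phi>: "\<And>t. bij_betw (\<Phi> t) (pv_space ?V t) (pv_space ?W t)"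
    "\<And>t x y. x \<in> pv_space ?V t \<Longrightarrow> y \<in> pv_space ?V t \<Longrightarrow> \<Phi> t (pv_add ?V t x y) = pv_add ?W t (\<Phi> t x) (\<Phi> t y)"
    "\<And>t r x. x \<in> pv_space ?V t \<Longrightarrow> \<Phi> t (pv_smult ?V t r x) = pv_smult ?W t r (\<Phi> t x)"
    "\<And>s t x. s \<le> t \<Longrightarrow> x \<in> pv_space ?V s \<Longrightarrow> \<Phi> t (pv_map ?V s t x) = pv_map ?W s t (\<Phi> s x)"
    using iso unfolding pv_isomorphic_def by metis
  \<comment> \<open>Truncation to the summands alive at both times: the result lies in both spaces
    and is fixed by the transition map.\<close>
  define e :: "(nat \<Rightarrow> 'k) \<Rightarrow> nat \<Rightarrow> 'k" where "e x = (\<lambda>i\<in>{..<length ps}. if i \<in> ?S then x i else 0)" for x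
  \<comment> \<open>Vectors of a direct sum are \<open>undefined\<close> beyond the list of
    summands. Putting 0 there makes \<open>T\<close> a linear map between full function
    spaces.\<close>
  define T where "T x = (\<lambda>j. if j < length qs then \<Phi> t (e x) j else 0)" for x
  have es: "e x \<in> pv_space ?V s" "e x \<in> pv_space ?V t" for x
    by (auto simp: e_def direct_sum_def interval_module_def)
  have e_map: "pv_map ?V s t (e x) = e x" for x
    by (auto simp: e_def direct_sum_def interval_module_def fun_eq_iff restrict_def)
  have e_add: "e (x + y) = pv_add ?V t (e x) (e y)" for x y
    by (auto simp: e_def direct_sum_def interval_module_def fun_eq_iff restrict_def)
  have e_scale: "e (fscale r x) = pv_smult ?V t r (e x)" for x r
    by (auto simp: e_def direct_sum_def interval_module_def fun_eq_iff restrict_def)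
  have \<Phi>e: "\<Phi> t (e x) \<in> pv_space ?W t" "\<Phi> s (e x) \<in> pv_space ?W s" for x
    using es \<Phi>(1) bij_betwE by blast+
  have T_supp: "T x j = 0" if "j \<notin> ?S'" for x j
  proof -
    have "\<Phi> t (e x) = pv_map ?W s t (\<Phi> s (e x))"
      using \<Phi>(4)[OF st es(1)[of x]] by (simp add: e_map)
    then show ?thesis
      using that by (auto simp: T_def direct_sum_def interval_module_def)
  qed
  have lin: "Vector_Spaces.linear fscale fscale T"
    unfolding Vector_Spaces.linear_iff
    by (auto simp: T_def e_add e_scale \<Phi>(2,3) es fun_eq_iff fs.vector_space_axioms)
      (auto simp: direct_sum_def interval_module_def)
  interpret T: Vector_Spaces.linear fscale fscale T by (rule lin)
  have T_inj: "e x = e y" if "T x = T y" for x y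
  proof -
    have "\<Phi> t (e x) = \<Phi> t (e y)"
    proof (rule PiE_ext)
      show "\<Phi> t (e x) \<in> (\<Pi>\<^sub>E i\<in>{..<length qs}. UNIV)" "\<Phi> t (e y) \<in> (\<Pi>\<^sub>E i\<in>{..<length qs}. UNIV)"
        using \<Phi>e(1) by (auto simp: direct_sum_def PiE_def)
      show "\<Phi> t (e x) j = \<Phi> t (e y) j" if "j \<in> {..<length qs}" for j
        using \<open>T x = T y\<close> that by (metis T_def lessThan_iff)
    qed
    then show ?thesis
      using \<Phi>(1)[of t] es(2) by (metis bij_betw_inv_into_left)
  qed
  have sub: "fs.subspace {x :: nat \<Rightarrow> 'k. \<forall>i. i \<notin> ?S \<longrightarrow> x i = 0}"
    by (rule fs.subspaceI) auto
  have span: "fs.span (unit_fun ` ?S) \<subseteq> {x :: nat \<Rightarrow> 'k. \<forall>i. i \<notin> ?S \<longrightarrow> x i = 0}"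
    by (rule fs.span_minimal[OF _ sub]) (auto simp: unit_fun_def)
  have inj: "inj_on T (fs.span (unit_fun ` ?S))"
  proof (intro inj_onI ext)
    fix x y i
    assume xy: "x \<in> fs.span (unit_fun ` ?S)" "y \<in> fs.span (unit_fun ` ?S)" "T x = T y"
    show "x i = y i"
    proof (cases "i \<in> ?S")
      case True
      then show ?thesis using fun_cong[OF T_inj[OF xy(3)], of i] by (simp add: e_def)
    next
      case False
      then have "x i = 0" "y i = 0" using xy(1,2) span by blast+
      then show ?thesis by simp
    qed
  qed
  have "fs.independent (T ` unit_fun ` ?S)"
    by (rule T.independent_injective_image[OF independent_unit_fun inj]) simp
  moreover have "T ` unit_fun ` ?S \<subseteq> fs.span (unit_fun ` ?S')"
    using T_supp by (intro image_subsetI in_span_unit_fun) auto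
  ultimately have "card (T ` unit_fun ` ?S) \<le> card (unit_fun ` ?S' :: (nat \<Rightarrow> 'k) set)"
    using fs.independent_span_bound[of "unit_fun ` ?S'" "T ` unit_fun ` ?S"] by simp
  also have "\<dots> \<le> card ?S'" by (rule card_image_le) simp
  also have "card (T ` unit_fun ` ?S) = card (unit_fun ` ?S :: (nat \<Rightarrow> 'k) set)"
    by (rule card_image) (rule inj_on_subset[OF inj fs.span_superset])
  also have "\<dots> = card ?S"
    by (rule card_image) (rule inj_on_subset[OF inj_unit_fun], simp)
  finally show ?thesis .
qed

lemma pv_space_direct_sum_interval_modules:
  "x \<in> pv_space (direct_sum (map interval_module ps) :: ('k::field, nat \<Rightarrow> 'k) persistence_vs) t \<longleftrightarrow>
    x \<in> extensional {..<length ps} \<and> (\<forall>i<length ps. \<not> in_interval (ps ! i) t \<longrightarrow> x i = 0)"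
  by (auto simp: direct_sum_def interval_module_def PiE_iff)

lemma pv_closed_direct_sum:
  "pv_closed (direct_sum (map interval_module ps) :: ('k::field, nat \<Rightarrow> 'k) persistence_vs)"
  unfolding pv_closed_def Ball_def pv_space_direct_sum_interval_modules
  by (simp add: direct_sum_def interval_module_def)

text \<open>Inverting the isomorphism gives the rank inequality in both directions, and the ranks
  determine the multiset.\<close>

lemma mset_eq_of_isomorphic:
  assumes iso: "pv_isomorphic (direct_sum (map interval_module ps) :: ('k::field, nat \<Rightarrow> 'k) persistence_vs)
      (direct_sum (map interval_module qs) :: ('k, nat \<Rightarrow> 'k) persistence_vs)"
    and "\<And>p. p \<in> set ps \<Longrightarrow> fst p < snd p" "\<And>p. p \<in> set qs \<Longrightarrow> fst p < snd p"
  shows "mset ps = mset qs"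
proof (rule interval_multiset_eqI)
  have rank: "size {#p \<in># mset rs. fst p \<le> ereal s \<and> ereal t < snd p#} =
    card {i. i < length rs \<and> in_interval (rs ! i) s \<and> in_interval (rs ! i) t}" if "s \<le> t" for rs s t
  proof -
    have "fst p \<le> ereal s \<and> ereal t < snd p \<longleftrightarrow> in_interval p s \<and> in_interval p t" for p
      using that ereal_less_eq(3)[of s t] unfolding in_interval_def
      by (meson dual_order.trans order.strict_trans1)
    then show ?thesis by (simp flip: mset_filter add: length_filter_conv_card)
  qed
  fix s t :: real assume "s \<le> t"
  then show "size {#p \<in># mset ps. fst p \<le> ereal s \<and> ereal t < snd p#} =
      size {#p \<in># mset qs. fst p \<le> ereal s \<and> ereal t < snd p#}"
    unfolding rank[OF \<open>s \<le> t\<close>]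
    using rank_le_of_isomorphic[OF iso, of s t]
      rank_le_of_isomorphic[OF pv_isomorphic_sym[OF iso pv_closed_direct_sum], of s t] by simp
qed (use assms in auto)

lemma diagram_eqI:
  fixes V :: "('k::field, 'v) persistence_vs"
  assumes "pv_isomorphic V (direct_sum (map interval_module ps))" "pv_closed V"
    and "\<And>p. p \<in> set ps \<Longrightarrow> fst p < snd p"
  shows "diagram V = mset ps"
  unfolding diagram_def
proof (rule the_equality)
  show "\<exists>qs. mset qs = mset ps \<and> (\<forall>p\<in>set qs. fst p < snd p) \<and>
      pv_isomorphic V (direct_sum (map interval_module qs))"
    using assms by blast
  fix D assume "\<exists>qs. mset qs = D \<and> (\<forall>p\<in>set qs. fst p < snd p) \<and>
      pv_isomorphic V (direct_sum (map interval_module qs))"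
  then obtain qs where qs: "mset qs = D" "\<forall>p\<in>set qs. fst p < snd p"
      "pv_isomorphic V (direct_sum (map interval_module qs))" by blast
  have "pv_isomorphic (direct_sum (map interval_module qs)) (direct_sum (map interval_module ps) :: ('k, nat \<Rightarrow> 'k) persistence_vs)"
    using pv_isomorphic_trans[OF pv_isomorphic_sym[OF qs(3) assms(2)] assms(1)] .
  from mset_eq_of_isomorphic[OF this] show "D = mset ps"
    using qs assms(3) by blast
qed

lemma diagram_cong:
  fixes U :: "('k::field, 'u) persistence_vs" and V :: "('k, 'v) persistence_vs"
  assumes "pv_isomorphic U V" "pv_closed U"
  shows "diagram U = diagram V"
proof -
  have "pv_isomorphic U W \<longleftrightarrow> pv_isomorphic V W" for W :: "('k, nat \<Rightarrow> 'k) persistence_vs"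
    using pv_isomorphic_trans[OF assms(1)] pv_isomorphic_trans[OF pv_isomorphic_sym[OF assms]] by blast
  then show ?thesis unfolding diagram_def by simp
qed

section \<open>Quotients of filtered subspaces\<close>

text \<open>The formulas of \<open>persistent_homology\<close> with arbitrary families of subspaces
  in place of cycles and boundaries, which separates the linear algebra from the topology.\<close>

definition quotient_pv ::
    "(real \<Rightarrow> ('i \<Rightarrow> 'k) set) \<Rightarrow> (real \<Rightarrow> ('i \<Rightarrow> 'k) set) \<Rightarrow> ('k::field, ('i \<Rightarrow> 'k) set) persistence_vs"
  where "quotient_pv Z B = \<lparr>
    pv_space = (\<lambda>t. {z +o B t | z. z \<in> Z t}),
    pv_add = (\<lambda>t A A'. A + A'),
    pv_smult = (\<lambda>t r A. (\<lambda>z i. r * z i) ` A + B t),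
    pv_map = (\<lambda>s t A. A + B t)\<rparr>"

lemma subset_plus_subspace:
  assumes "fs.subspace B" "0 \<in> C" "C \<subseteq> B"
  shows "C + B = B"
proof
  show "C + B \<subseteq> B"
    using assms fs.subspace_add by (auto elim!: set_plus_elim)
  show "B \<subseteq> C + B" using assms(2) by (rule set_zero_plus2)
qed

locale persistent_subspaces =
  fixes Z B :: "real \<Rightarrow> ('i \<Rightarrow> 'k::field) set"
  assumes subspace_Z: "fs.subspace (Z t)" and subspace_B: "fs.subspace (B t)"
    and B_le_Z: "B t \<subseteq> Z t"
    and Z_mono: "s \<le> t \<Longrightarrow> Z s \<subseteq> Z t" and B_mono: "s \<le> t \<Longrightarrow> B s \<subseteq> B t"
begin

lemma coset_add: "(x +o B t) + (y +o B t) = (x + y) +o B t"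
  using subset_plus_subspace[OF subspace_B fs.subspace_0[OF subspace_B] order_refl]
  by (simp add: set_plus_rearrange)

lemma coset_scale: "fscale r ` (x +o B t) + B t = fscale r x +o B t"
proof -
  have "fscale r ` (x +o B t) = fscale r x +o fscale r ` B t"
    by (force simp: elt_set_plus_def fun_eq_iff algebra_simps)
  moreover have "fscale r ` B t + B t = B t"
  proof (rule subset_plus_subspace[OF subspace_B])
    show "0 \<in> fscale r ` B t"
      by (rule image_eqI[OF _ fs.subspace_0[OF subspace_B]]) auto
    show "fscale r ` B t \<subseteq> B t"
      using fs.subspace_scale[OF subspace_B] by blast
  qed
  ultimately show ?thesis by (simp add: set_plus_rearrange3)
qed

lemma coset_map: "s \<le> t \<Longrightarrow> (x +o B s) + B t = x +o B t"
  using subset_plus_subspace[OF subspace_B fs.subspace_0[OF subspace_B] B_mono]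
  by (simp add: set_plus_rearrange3)

lemma coset_eq_iff: "x +o B t = y +o B t \<longleftrightarrow> x - y \<in> B t"
proof
  have "x \<in> x +o B t"
    using fs.subspace_0[OF subspace_B] by (force simp: elt_set_plus_def)
  then show "x - y \<in> B t" if "x +o B t = y +o B t"
    using that by (simp add: set_minus_plus)
  assume xy: "x - y \<in> B t"
  have "(x - y) +o B t = B t"
  proof
    show "(x - y) +o B t \<subseteq> B t"
      using xy fs.subspace_add[OF subspace_B] by (auto simp: elt_set_plus_def)
    show "B t \<subseteq> (x - y) +o B t"
      using fs.subspace_diff[OF subspace_B _ xy] by (force simp: elt_set_plus_def)
  qed
  then have "y +o ((x - y) +o B t) = y +o B t" by simp
  then show "x +o B t = y +o B t" by (simp add: set_plus_rearrange2)
qed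

lemma pv_closed_quotient: "pv_closed (quotient_pv Z B)"
  using fs.subspace_add[OF subspace_Z] fs.subspace_scale[OF subspace_Z] Z_mono
  by (auto simp: pv_closed_def quotient_pv_def coset_add coset_scale coset_map) blast+

text \<open>The first isomorphism theorem for persistence modules. The kernel is described by
  equality of values because a \<open>persistence_vs\<close> has neither a zero nor a subtraction. A
  coset is mapped through a chosen representative, and \<open>ker\<close> shows independence of the
  choice.\<close>

lemma quotient_isomorphicI:
  fixes W :: "('k, 'w) persistence_vs"
  assumes space: "\<And>t. L t ` Z t = pv_space W t"
    and add: "\<And>t x y. x \<in> Z t \<Longrightarrow> y \<in> Z t \<Longrightarrow> L t (x + y) = pv_add W t (L t x) (L t y)"
    and scale: "\<And>t r x. x \<in> Z t \<Longrightarrow> L t (fscale r x) = pv_smult W t r (L t x)"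
    and ker: "\<And>t x y. x \<in> Z t \<Longrightarrow> y \<in> Z t \<Longrightarrow> L t x = L t y \<longleftrightarrow> x - y \<in> B t"
    and natural: "\<And>s t x. s \<le> t \<Longrightarrow> x \<in> Z s \<Longrightarrow> L t x = pv_map W s t (L s x)"
  shows "pv_isomorphic (quotient_pv Z B) W"
proof -
  define \<Phi> where "\<Phi> t A = L t (SOME x. x \<in> A)" for t A
  have \<Phi>: "\<Phi> t (x +o B t) = L t x" if x: "x \<in> Z t" for t x
  proof -
    have "x \<in> x +o B t"
      using fs.subspace_0[OF subspace_B] by (force simp: elt_set_plus_def)
    then have "(SOME y. y \<in> x +o B t) \<in> x +o B t" by (rule someI[of "\<lambda>y. y \<in> x +o B t"])
    then obtain b where b: "b \<in> B t" "(SOME y. y \<in> x +o B t) = x + b"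
      by (auto simp: elt_set_plus_def)
    then show ?thesis
      unfolding \<Phi>_def using ker[of "x + b" t x] x B_le_Z fs.subspace_add[OF subspace_Z]
      by (simp add: subset_iff)
  qed
  have bij: "bij_betw (\<Phi> t) (pv_space (quotient_pv Z B) t) (pv_space W t)" for t
    unfolding bij_betw_def
  proof
    show "inj_on (\<Phi> t) (pv_space (quotient_pv Z B) t)"
      by (auto intro!: inj_onI simp: quotient_pv_def \<Phi> ker simp flip: coset_eq_iff)
    show "\<Phi> t ` pv_space (quotient_pv Z B) t = pv_space W t"
      unfolding space[symmetric] by (force simp: quotient_pv_def \<Phi> image_iff)
  qed
  show ?thesis
    unfolding pv_isomorphic_def
  proof (intro exI[of _ \<Phi>] conjI allI impI)
    show "\<forall>x\<in>pv_space (quotient_pv Z B) t. \<forall>y\<in>pv_space (quotient_pv Z B) t.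
        \<Phi> t (pv_add (quotient_pv Z B) t x y) = pv_add W t (\<Phi> t x) (\<Phi> t y)" for t
      using fs.subspace_add[OF subspace_Z] by (auto simp: quotient_pv_def coset_add \<Phi> add)
    show "\<forall>x\<in>pv_space (quotient_pv Z B) t. \<Phi> t (pv_smult (quotient_pv Z B) t r x) = pv_smult W t r (\<Phi> t x)" for t r
      using fs.subspace_scale[OF subspace_Z] by (auto simp: quotient_pv_def coset_scale \<Phi> scale)
    show "\<forall>x\<in>pv_space (quotient_pv Z B) s. \<Phi> t (pv_map (quotient_pv Z B) s t x) = pv_map W s t (\<Phi> s x)" if "s \<le> t" for s t
      using that Z_mono[OF that] by (auto simp: quotient_pv_def coset_map \<Phi> natural subset_iff)
  qed (rule bij)
qed

end

text \<open>Coordinates over \<open>E \<inter> G\<close> are also the coordinates over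
  \<open>E\<close>. Adaptedness thus turns all spaces of the flags into coordinate subspaces, which
  is what splits the module into one-dimensional pieces.\<close>

lemma (in vector_space) mem_adapted_iff:
  assumes "independent E" "subspace G" "G \<subseteq> span (E \<inter> G)"
  shows "w \<in> G \<longleftrightarrow> w \<in> span E \<and> (\<forall>e. representation E w e \<noteq> 0 \<longrightarrow> e \<in> G)"
proof
  assume "w \<in> G"
  then have w: "w \<in> span (E \<inter> G)" using assms(3) by blast
  then have "representation E w = representation (E \<inter> G) w"
    using assms(1) by (intro representation_extend) auto
  then show "w \<in> span E \<and> (\<forall>e. representation E w e \<noteq> 0 \<longrightarrow> e \<in> G)"
    using w span_mono[of "E \<inter> G" E] representation_ne_zero[of "E \<inter> G" w] by auto
next
  assume *: "w \<in> span E \<and> (\<forall>e. representation E w e \<noteq> 0 \<longrightarrow> e \<in> G)"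
  have "(\<Sum>e | representation E w e \<noteq> 0. scale (representation E w e) e) \<in> G"
    using * assms(2) by (intro subspace_sum subspace_scale) auto
  then show "w \<in> G"
    using sum_nonzero_representation_eq[OF assms(1)] * by simp
qed

section \<open>Diagrams from adapted bases\<close>

text \<open>The time at which \<open>e\<close> enters the filtration: \<open>\<infinity>\<close> if
  it never does, \<open>-\<infinity>\<close> if it is always there.\<close>

definition threshold :: "(real \<Rightarrow> 'v set) \<Rightarrow> 'v \<Rightarrow> ereal"
  where "threshold G e = (INF t\<in>{t. e \<in> G t}. ereal t)"

text \<open>The hypothesis \<open>right\<close> keeps an element that is missing at \<open>t\<close>
  away until some later \<open>t'\<close>, so a finite infimum is attained. This is why the
  intervals are closed on the left and open on the right.\<close>

lemma threshold_le_iff: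
  assumes mono: "\<And>s t. s \<le> t \<Longrightarrow> G s \<subseteq> G t" and right: "\<And>s. \<exists>t>s. G t = G s"
  shows "threshold G e \<le> ereal t \<longleftrightarrow> e \<in> G t"
proof
  assume le: "threshold G e \<le> ereal t"
  show "e \<in> G t"
  proof (rule ccontr)
    assume "e \<notin> G t"
    obtain t' where t': "t' > t" "G t' = G t" using right by blast
    have "ereal t' \<le> ereal r" if "e \<in> G r" for r
      using that mono[of r t'] t'(2) \<open>e \<notin> G t\<close> by fastforce
    then have "ereal t' \<le> threshold G e"
      unfolding threshold_def by (intro INF_greatest) auto
    then show False using le t'(1) by (metis ereal_less_eq(3) leD order.trans)
  qed
qed (auto simp: threshold_def intro: INF_lower)

text \<open>Adding diagonal points turns partial matchings into perfect ones, which can be composed.\<close>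

definition bottleneck_close ::
    "real \<Rightarrow> (ereal \<times> ereal) multiset \<Rightarrow> (ereal \<times> ereal) multiset \<Rightarrow> bool"
  where "bottleneck_close \<epsilon> A A' \<longleftrightarrow> (\<exists>D D'. (\<forall>p\<in>#D. fst p = snd p) \<and> (\<forall>p\<in>#D'. fst p = snd p) \<and>
    rel_mset (\<lambda>p q. linf_dist p q \<le> ereal \<epsilon>) (A + D) (A' + D'))"

lemma threshold_shift:
  assumes "\<And>t. G t \<subseteq> G' (t + \<epsilon>)"
  shows "threshold G' e \<le> threshold G e + ereal \<epsilon>"
proof -
  have "threshold G' e - ereal \<epsilon> \<le> threshold G e"
    unfolding threshold_def[of G]
  proof (rule INF_greatest)
    fix t assume "t \<in> {t. e \<in> G t}"
    then have "e \<in> G' (t + \<epsilon>)" using assms by blast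
    then have "threshold G' e \<le> ereal (t + \<epsilon>)"
      unfolding threshold_def by (intro INF_lower) auto
    then show "threshold G' e - ereal \<epsilon> \<le> ereal t"
      by (cases "threshold G' e") auto
  qed
  then show ?thesis
    by (cases "threshold G' e"; cases "threshold G e") auto
qed

lemma ext_dist_threshold_le:
  assumes "\<And>t. G t \<subseteq> G' (t + \<epsilon>)" "\<And>t. G' t \<subseteq> G (t + \<epsilon>)" "0 \<le> \<epsilon>"
  shows "ext_dist (threshold G e) (threshold G' e) \<le> ereal \<epsilon>"
  using threshold_shift[of G G' \<epsilon>, OF assms(1), of e] threshold_shift[of G' G \<epsilon>, OF assms(2), of e] assms(3)
  by (cases "threshold G' e"; cases "threshold G e") (auto simp: ext_dist_def)

locale adapted_persistent_subspaces = persistent_subspaces Z B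
  for Z B :: "real \<Rightarrow> ('i \<Rightarrow> 'k::field) set" +
  fixes E :: "('i \<Rightarrow> 'k) set"
  assumes right_Z: "\<And>s. \<exists>t>s. Z t = Z s" and right_B: "\<And>s. \<exists>t>s. B t = B s"
    and finite_E: "finite E" and indep: "fs.independent E"
    and adapted_Z: "Z t \<subseteq> fs.span (E \<inter> Z t)" and adapted_B: "B t \<subseteq> fs.span (E \<inter> B t)"
begin

definition lifespan :: "('i \<Rightarrow> 'k) \<Rightarrow> ereal \<times> ereal"
  where "lifespan e = (threshold Z e, threshold B e)"

lemma in_interval_lifespan: "in_interval (lifespan e) t \<longleftrightarrow> e \<in> Z t \<and> e \<notin> B t"
proof -
  have "ereal t < threshold B e \<longleftrightarrow> e \<notin> B t"
    using threshold_le_iff[of B e t, OF B_mono right_B] by (metis not_le)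
  then show ?thesis
    using threshold_le_iff[of Z e t, OF Z_mono right_Z] by (simp add: in_interval_def lifespan_def)
qed

text \<open>A vector of \<open>Z t\<close> is mapped to its coefficients at the basis elements that
  are in \<open>Z t\<close> but not in \<open>B t\<close>. The coefficients at elements of
  \<open>B t\<close> are exactly what the quotient forgets, and elements with empty lifespan never
  contribute.\<close>

lemma isomorphic_direct_sum:
  assumes es: "distinct es" "set es = {e \<in> E. fst (lifespan e) < snd (lifespan e)}"
  shows "pv_isomorphic (quotient_pv Z B)
    (direct_sum (map interval_module (map lifespan es)) :: ('k, nat \<Rightarrow> 'k) persistence_vs)"
proof -
  let ?W = "direct_sum (map interval_module (map lifespan es)) :: ('k, nat \<Rightarrow> 'k) persistence_vs"
  let ?rep = "fs.representation E"
  define L where "L t x = (\<lambda>i\<in>{..<length es}. if in_interval (lifespan (es ! i)) t then ?rep x (es ! i) else 0)" for t x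
  have Z_iff: "w \<in> Z t \<longleftrightarrow> w \<in> fs.span E \<and> (\<forall>e. ?rep w e \<noteq> 0 \<longrightarrow> e \<in> Z t)" for w t
    by (rule fs.mem_adapted_iff[OF indep subspace_Z adapted_Z])
  then have Z_span: "w \<in> fs.span E" if "w \<in> Z t" for w t using that by blast
  have B_iff: "w \<in> B t \<longleftrightarrow> w \<in> fs.span E \<and> (\<forall>e. ?rep w e \<noteq> 0 \<longrightarrow> e \<in> B t)" for w t
    by (rule fs.mem_adapted_iff[OF indep subspace_B adapted_B])
  have es_E: "es ! i \<in> E" if "i < length es" for i
    using that es(2) nth_mem by blast
  show ?thesis
  proof (rule quotient_isomorphicI[of L])
    show "L t ` Z t = pv_space ?W t" for t
    proof
      show "L t ` Z t \<subseteq> pv_space ?W t"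
        unfolding image_subset_iff pv_space_direct_sum_interval_modules Ball_def
        by (simp add: L_def)
      show "pv_space ?W t \<subseteq> L t ` Z t"
      proof
        fix y assume "y \<in> pv_space ?W t"
        then have y: "y \<in> extensional {..<length es}"
            "\<And>i. i < length es \<Longrightarrow> \<not> in_interval (lifespan (es ! i)) t \<Longrightarrow> y i = 0"
          unfolding pv_space_direct_sum_interval_modules by auto
        \<comment> \<open>An element of \<open>es\<close> outside \<open>Z t\<close> is not alive at
          \<open>t\<close>, so its coefficient \<open>y i\<close> is zero and the sum stays in
          \<open>Z t\<close>.\<close>
        define x where "x = (\<Sum>i<length es. fscale (y i) (es ! i))"
        have "x \<in> Z t"
          unfolding x_def
        proof (rule fs.subspace_sum[OF subspace_Z])
          fix i assume "i \<in> {..<length es}"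
          then show "fscale (y i) (es ! i) \<in> Z t"
            using y(2)[of i] in_interval_lifespan fs.subspace_scale[OF subspace_Z, of "es ! i" t "y i"]
              fs.subspace_0[OF subspace_Z] by (cases "in_interval (lifespan (es ! i)) t") (auto simp: zero_fun_def)
        qed
        moreover have "L t x = y"
        proof
          fix j
          show "L t x j = y j"
          proof (cases "j < length es")
            case True
            have "?rep x (es ! j) = (\<Sum>i<length es. ?rep (fscale (y i) (es ! i)) (es ! j))"
              unfolding x_def using es_E
              by (subst fs.representation_sum[OF indep]) (auto intro!: fs.span_scale[OF fs.span_base])
            also have "\<dots> = (\<Sum>i<length es. if i = j then y i else 0)"
            proof (rule sum.cong[OF refl])
              fix i assume "i \<in> {..<length es}"
              then have i: "i < length es" by simp
              have "?rep (fscale (y i) (es ! i)) (es ! j) = y i * ?rep (es ! i) (es ! j)"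
                using fs.representation_scale[OF indep fs.span_base[OF es_E[OF i]], of "y i"] by simp
              then show "?rep (fscale (y i) (es ! i)) (es ! j) = (if i = j then y i else 0)"
                using fs.representation_basis[OF indep es_E[OF i]] i True es(1)
                by (simp add: nth_eq_iff_index_eq)
            qed
            also have "\<dots> = y j" using True by simp
            finally show ?thesis using True y(2)[OF True] by (simp add: L_def)
          next
            case False
            then show ?thesis using y(1) by (simp add: L_def extensional_def)
          qed
        qed
        ultimately show "y \<in> L t ` Z t" by blast
      qed
    qed
    show "L t (x + y) = pv_add ?W t (L t x) (L t y)" if "x \<in> Z t" "y \<in> Z t" for t x y
    proof -
      have "?rep (x + y) = (\<lambda>e. ?rep x e + ?rep y e)"
        by (rule fs.representation_add[OF indep Z_span[OF that(2)] Z_span[OF that(1)]])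
      then show ?thesis by (intro ext) (simp add: L_def direct_sum_def interval_module_def)
    qed
    show "L t (fscale r x) = pv_smult ?W t r (L t x)" if "x \<in> Z t" for t r x
    proof -
      have "?rep (fscale r x) = (\<lambda>e. r * ?rep x e)"
        by (rule fs.representation_scale[OF indep Z_span[OF that]])
      then show ?thesis by (intro ext) (simp add: L_def direct_sum_def interval_module_def)
    qed
    show "L t x = L t y \<longleftrightarrow> x - y \<in> B t" if xy: "x \<in> Z t" "y \<in> Z t" for t x y
    proof -
      have w: "x - y \<in> Z t" by (rule fs.subspace_diff[OF subspace_Z xy])
      have rep: "?rep (x - y) = (\<lambda>e. ?rep x e - ?rep y e)"
        by (rule fs.representation_diff[OF indep Z_span[OF xy(2)] Z_span[OF xy(1)]])
      show ?thesis
      proof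
        assume eq: "L t x = L t y"
        \<comment> \<open>A basis element at which \<open>x\<close> and \<open>y\<close> differ lies
          in \<open>Z t\<close>. Outside \<open>B t\<close> it would be alive at \<open>t\<close>,
          hence listed in \<open>es\<close>, where \<open>L\<close> records equal
          coefficients.\<close>
        have "e \<in> B t" if ne: "?rep (x - y) e \<noteq> 0" for e
        proof (rule ccontr)
          assume "e \<notin> B t"
          moreover have "e \<in> Z t" using w Z_iff ne by blast
          ultimately have int: "in_interval (lifespan e) t" using in_interval_lifespan by simp
          then have "fst (lifespan e) < snd (lifespan e)"
            unfolding in_interval_def by (rule conjE) (rule order.strict_trans1)
          moreover have "e \<in> E" using ne by (rule fs.representation_ne_zero)
          ultimately obtain i where i: "i < length es" "es ! i = e"
            using es(2) by (metis (mono_tags, lifting) in_set_conv_nth mem_Collect_eq)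
          show False
            using fun_cong[OF eq, of i] i int ne rep by (simp add: L_def)
        qed
        then show "x - y \<in> B t" using w B_iff Z_iff by blast
      next
        assume "x - y \<in> B t"
        then have "?rep x e = ?rep y e" if "e \<notin> B t" for e
          using that B_iff[of "x - y" t] rep by auto
        then show "L t x = L t y"
          by (auto simp: L_def fun_eq_iff in_interval_lifespan)
      qed
    qed
    show "L t x = pv_map ?W s t (L s x)" if "s \<le> t" "x \<in> Z s" for s t x
    proof -
      \<comment> \<open>An element alive at \<open>t\<close> is not in \<open>B t\<close> and so not
        in \<open>B s\<close>. If it is not alive at \<open>s\<close>, it is therefore missing from
        \<open>Z s\<close>, and \<open>x\<close> cannot involve it.\<close>
      have "?rep x (es ! i) = 0" if "\<not> in_interval (lifespan (es ! i)) s" "in_interval (lifespan (es ! i)) t" for i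
        using that B_mono[OF \<open>s \<le> t\<close>] \<open>x \<in> Z s\<close> Z_iff[of x s] unfolding in_interval_lifespan by blast
      then show ?thesis
        by (intro ext) (simp add: L_def direct_sum_def interval_module_def)
    qed
  qed
qed

lemma diagram_quotient:
  "diagram (quotient_pv Z B) = {#p \<in># image_mset lifespan (mset_set E). fst p < snd p#}"
proof -
  obtain es where es: "distinct es" "set es = {e \<in> E. fst (lifespan e) < snd (lifespan e)}"
    using finite_distinct_list[of "{e \<in> E. fst (lifespan e) < snd (lifespan e)}"] finite_E by auto
  have "diagram (quotient_pv Z B) = mset (map lifespan es)"
    using es(2) by (intro diagram_eqI[OF isomorphic_direct_sum[OF es] pv_closed_quotient]) auto
  also have "\<dots> = image_mset lifespan (mset_set (set es))"
    using es(1) by (simp add: mset_set_set)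
  also have "\<dots> = {#p \<in># image_mset lifespan (mset_set E). fst p < snd p#}"
    unfolding es(2) by (simp add: filter_mset_image_mset filter_mset_mset_set finite_E)
  finally show ?thesis .
qed

text \<open>As \<open>B t \<subseteq> Z t\<close>, no element dies before its birth, so the points
  dropped from the diagram are diagonal. Putting them back makes \<open>E\<close> an index set for
  the points.\<close>

lemma diagram_quotient_plus_diagonal:
  "\<exists>D. (\<forall>p\<in>#D. fst p = snd p) \<and>
    diagram (quotient_pv Z B) + D = image_mset lifespan (mset_set E)"
proof (intro exI conjI)
  let ?D = "{#p \<in># image_mset lifespan (mset_set E). \<not> fst p < snd p#}"
  show "diagram (quotient_pv Z B) + ?D = image_mset lifespan (mset_set E)"
    unfolding diagram_quotient by (rule multiset_partition[symmetric])
  have "threshold Z e \<le> threshold B e" for e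
    unfolding threshold_def using B_le_Z by (intro INF_superset_mono) auto
  then show "\<forall>p\<in>#?D. fst p = snd p"
    by (auto simp: lifespan_def order.antisym)
qed

end

text \<open>The perfect matching pairs the two lifespans of the same \<open>e\<close>. The
  inclusions of cycles control the births, those of boundaries the deaths.\<close>

lemma bottleneck_close_adapted:
  assumes "adapted_persistent_subspaces Z B E" "adapted_persistent_subspaces Z' B' E"
    and "\<And>t. Z t \<subseteq> Z' (t + \<epsilon>)" "\<And>t. Z' t \<subseteq> Z (t + \<epsilon>)"
    and "\<And>t. B t \<subseteq> B' (t + \<epsilon>)" "\<And>t. B' t \<subseteq> B (t + \<epsilon>)" and "0 \<le> \<epsilon>"
  shows "bottleneck_close \<epsilon> (diagram (quotient_pv Z B)) (diagram (quotient_pv Z' B'))"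
proof -
  interpret V: adapted_persistent_subspaces Z B E by fact
  interpret V': adapted_persistent_subspaces Z' B' E by fact
  obtain D where D: "\<forall>p\<in>#D. fst p = snd p"
    "diagram (quotient_pv Z B) + D = image_mset V.lifespan (mset_set E)"
    using V.diagram_quotient_plus_diagonal by blast
  obtain D' where D': "\<forall>p\<in>#D'. fst p = snd p"
    "diagram (quotient_pv Z' B') + D' = image_mset V'.lifespan (mset_set E)"
    using V'.diagram_quotient_plus_diagonal by blast
  have "linf_dist (V.lifespan e) (V'.lifespan e) \<le> ereal \<epsilon>" for e
    using ext_dist_threshold_le[of Z Z' \<epsilon>] ext_dist_threshold_le[of B B' \<epsilon>] assms(3-)
    by (simp add: linf_dist_def V.lifespan_def V'.lifespan_def)
  then have "rel_mset (\<lambda>p q. linf_dist p q \<le> ereal \<epsilon>)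
      (image_mset V.lifespan (mset_set E)) (image_mset V'.lifespan (mset_set E))"
    by (simp add: multiset.rel_map multiset.rel_refl_strong)
  then show ?thesis
    unfolding bottleneck_close_def using D D' by metis
qed

section \<open>Bottleneck distance\<close>

lemma linf_dist_triangle: "linf_dist p r \<le> linf_dist p q + linf_dist q r"
proof -
  have ext: "ext_dist a c \<le> ext_dist a b + ext_dist b c" for a b c
    by (cases a; cases b; cases c) (auto simp: ext_dist_def)
  show ?thesis
    unfolding linf_dist_def
    by (intro max.boundedI order.trans[OF ext[of _ _ "fst q"]] order.trans[OF ext[of _ _ "snd q"]]
        add_mono max.cobounded1 max.cobounded2)
qed

lemma linf_dist_commute: "linf_dist p q = linf_dist q p"
proof -
  have "ext_dist a b = ext_dist b a" for a b
    by (cases a; cases b) (auto simp: ext_dist_def)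
  then show ?thesis by (simp add: linf_dist_def)
qed

lemma rel_mset_union:
  assumes "rel_mset R A B" "rel_mset R C D"
  shows "rel_mset R (A + C) (B + D)"
  using assms by induction (auto intro: rel_mset_Plus)

text \<open>The two matchings meet in different enlargements of \<open>B\<close>. Adding
  \<open>D3\<close> to the first and \<open>D2\<close> to the second, each matched identically,
  produces the common middle multiset \<open>B + D2 + D3\<close>.\<close>

lemma bottleneck_close_trans:
  assumes "bottleneck_close \<epsilon> A B" "bottleneck_close \<delta> B C" "0 \<le> \<epsilon>" "0 \<le> \<delta>"
  shows "bottleneck_close (\<epsilon> + \<delta>) A C"
proof -
  let ?R = "\<lambda>\<epsilon> p q. linf_dist p q \<le> ereal \<epsilon>"
  obtain D1 D2 where D12: "\<forall>p\<in>#D1. fst p = snd p" "\<forall>p\<in>#D2. fst p = snd p"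
      "rel_mset (?R \<epsilon>) (A + D1) (B + D2)"
    using assms(1) unfolding bottleneck_close_def by blast
  obtain D3 D4 where D34: "\<forall>p\<in>#D3. fst p = snd p" "\<forall>p\<in>#D4. fst p = snd p"
      "rel_mset (?R \<delta>) (B + D3) (C + D4)"
    using assms(2) unfolding bottleneck_close_def by blast
  have refl: "rel_mset (?R \<eta>) D D" if "0 \<le> \<eta>" for D \<eta>
    using that by (intro multiset.rel_refl_strong) (simp add: linf_dist_def ext_dist_def)
  have "rel_mset (?R \<epsilon>) (A + D1 + D3) (B + D2 + D3)"
    by (rule rel_mset_union[OF D12(3) refl[OF assms(3)]])
  moreover have "rel_mset (?R \<delta>) (B + D2 + D3) (C + D4 + D2)"
    using rel_mset_union[OF D34(3) refl[OF assms(4)], of D2] by (simp add: ac_simps)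
  ultimately have "rel_mset (?R \<epsilon> OO ?R \<delta>) (A + D1 + D3) (C + D4 + D2)"
    by (auto simp: multiset.rel_compp)
  moreover have "?R \<epsilon> OO ?R \<delta> \<le> ?R (\<epsilon> + \<delta>)"
  proof (rule predicate2I)
    fix p r assume "(?R \<epsilon> OO ?R \<delta>) p r"
    then obtain q where "linf_dist p q \<le> ereal \<epsilon>" "linf_dist q r \<le> ereal \<delta>" by blast
    then have "linf_dist p q + linf_dist q r \<le> ereal \<epsilon> + ereal \<delta>" by (rule add_mono)
    then show "linf_dist p r \<le> ereal (\<epsilon> + \<delta>)"
      using linf_dist_triangle[of p r q] by simp
  qed
  ultimately have "rel_mset (?R (\<epsilon> + \<delta>)) (A + (D1 + D3)) (C + (D4 + D2))"
    using multiset.rel_mono[of "?R \<epsilon> OO ?R \<delta>" "?R (\<epsilon> + \<delta>)"] by (simp add: add.assoc le_fun_def)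
  then show ?thesis
    unfolding bottleneck_close_def using D12(1,2) D34(1,2)
    by (intro exI[of _ "D1 + D3"] exI[of _ "D4 + D2"]) auto
qed

text \<open>Only pairs with both points off the diagonal are kept. An unmatched point of
  \<open>A\<close> or \<open>B\<close> was paired with a diagonal point, which bounds its distance
  to the diagonal.\<close>

lemma bottleneck_dist_le:
  assumes close: "bottleneck_close \<epsilon> A B" and "0 \<le> \<epsilon>"
    and A: "\<And>p. p \<in># A \<Longrightarrow> fst p < snd p" and B: "\<And>p. p \<in># B \<Longrightarrow> fst p < snd p"
  shows "bottleneck_dist A B \<le> ereal \<epsilon>"
proof -
  obtain D D' where D: "\<forall>p\<in>#D. fst p = snd p" and D': "\<forall>p\<in>#D'. fst p = snd p"
      and rel: "rel_mset (\<lambda>p q. linf_dist p q \<le> ereal \<epsilon>) (A + D) (B + D')"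
    using close unfolding bottleneck_close_def by blast
  obtain P where P: "\<And>p q. (p, q) \<in># P \<Longrightarrow> linf_dist p q \<le> ereal \<epsilon>"
      "image_mset fst P = A + D" "image_mset snd P = B + D'"
    using rel unfolding multiset.in_rel by blast
  \<comment> \<open>Filtering by \<open>off\<close> recovers \<open>A\<close> from
    \<open>A + D\<close> and \<open>B\<close> from \<open>B + D'\<close>.\<close>
  define off :: "ereal \<times> ereal \<Rightarrow> bool" where "off p \<longleftrightarrow> fst p < snd p" for p
  define M where "M = {#x \<in># P. off (fst x) \<and> off (snd x)#}"
  have "filter_mset off A = A" "filter_mset off D = {#}"
    using A D by (auto simp: off_def filter_mset_eq_conv filter_mset_eq_mempty_iff)
  then have "A = filter_mset off (image_mset fst P)" using P(2) by simp
  also have "\<dots> = image_mset fst {#x \<in># P. off (fst x)#}"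
    by (simp add: filter_mset_image_mset)
  also have "{#x \<in># P. off (fst x)#} = M + {#x \<in># P. off (fst x) \<and> \<not> off (snd x)#}"
    unfolding M_def by (subst multiset_partition[of _ "\<lambda>x. off (snd x)"]) (simp add: filter_filter_mset)
  finally have A_eq: "A = image_mset fst M + image_mset fst {#x \<in># P. off (fst x) \<and> \<not> off (snd x)#}"
    by simp
  have "filter_mset off B = B" "filter_mset off D' = {#}"
    using B D' by (auto simp: off_def filter_mset_eq_conv filter_mset_eq_mempty_iff)
  then have "B = filter_mset off (image_mset snd P)" using P(3) by simp
  also have "\<dots> = image_mset snd {#x \<in># P. off (snd x)#}"
    by (simp add: filter_mset_image_mset)
  also have "{#x \<in># P. off (snd x)#} = M + {#x \<in># P. off (snd x) \<and> \<not> off (fst x)#}"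
    unfolding M_def by (subst multiset_partition[of _ "\<lambda>x. off (fst x)"]) (simp add: filter_filter_mset conj_commute)
  finally have B_eq: "B = image_mset snd M + image_mset snd {#x \<in># P. off (snd x) \<and> \<not> off (fst x)#}"
    by simp
  have diag: "diag_dist p \<le> linf_dist p q" if "fst q = snd q" for p q
    using that unfolding diag_dist_def by (cases q) (auto intro: INF_lower)
  have diag_snd: "fst q = snd q" if "(p, q) \<in># P" "\<not> off q" for p q
  proof -
    have "q \<in># B + D'" using that(1) by (force simp flip: P(3))
    then show ?thesis using that(2) B D' unfolding off_def by auto
  qed
  have diag_fst: "fst p = snd p" if "(p, q) \<in># P" "\<not> off p" for p q
  proof -
    have "p \<in># A + D" using that(1) by (force simp flip: P(2))
    then show ?thesis using that(2) A D unfolding off_def by auto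
  qed
  have "partial_matching A B M"
    unfolding partial_matching_def mset_subset_eq_exists_conv using A_eq B_eq by blast
  moreover have "matching_cost A B M \<le> ereal \<epsilon>"
    unfolding matching_cost_def
  proof (rule Sup_least)
    fix z assume z: "z \<in> insert 0 ((\<lambda>(p, q). linf_dist p q) ` set_mset M \<union>
        diag_dist ` set_mset (A - image_mset fst M) \<union> diag_dist ` set_mset (B - image_mset snd M))"
    have 1: "diag_dist p \<le> ereal \<epsilon>" if "p \<in># A - image_mset fst M" for p
    proof -
      have "p \<in># image_mset fst {#x \<in># P. off (fst x) \<and> \<not> off (snd x)#}"
        using that arg_cong[OF A_eq, of "\<lambda>C. C - image_mset fst M"] by simp
      then obtain q where q: "(p, q) \<in># P" "\<not> off q" by auto
      show ?thesis using diag[OF diag_snd[OF q]] P(1)[OF q(1)] order.trans by blast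
    qed
    have 2: "diag_dist q \<le> ereal \<epsilon>" if "q \<in># B - image_mset snd M" for q
    proof -
      have "q \<in># image_mset snd {#x \<in># P. off (snd x) \<and> \<not> off (fst x)#}"
        using that arg_cong[OF B_eq, of "\<lambda>C. C - image_mset snd M"] by simp
      then obtain p where p: "(p, q) \<in># P" "\<not> off p" by auto
      show ?thesis using diag[OF diag_fst[OF p], of q] P(1)[OF p(1)] order.trans
        unfolding linf_dist_commute[of q p] by blast
    qed
    have 3: "linf_dist p q \<le> ereal \<epsilon>" if "(p, q) \<in># M" for p q
      using that P(1) by (simp add: M_def)
    show "z \<le> ereal \<epsilon>" using z 1 2 3 \<open>0 \<le> \<epsilon>\<close> by auto
  qed
  ultimately show ?thesis
    unfolding bottleneck_dist_def by (intro INF_lower2) auto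
qed

text \<open>
  Moving along the segment from \<open>w\<close> to \<open>w'\<close>, stop at the first parameter where some inverted pair
  gets equal values: no pair is inverted before that, and fewer pairs are inverted afterwards.
\<close>

lemma interpolation_induct:
  fixes w w' :: "'u \<Rightarrow> real"
  assumes "finite U" and "0 \<le> \<epsilon>" "\<And>u. u \<in> U \<Longrightarrow> \<bar>w u - w' u\<bar> \<le> \<epsilon>"
    and base: "\<And>w w' \<epsilon>. 0 \<le> \<epsilon> \<Longrightarrow> (\<And>u. u \<in> U \<Longrightarrow> \<bar>w u - w' u\<bar> \<le> \<epsilon>) \<Longrightarrow>
      (\<And>u v. u \<in> U \<Longrightarrow> v \<in> U \<Longrightarrow> w u < w v \<Longrightarrow> w' u \<le> w' v) \<Longrightarrow> P \<epsilon> w w'"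
    and trans: "\<And>\<epsilon> \<delta> w w' w''. 0 \<le> \<epsilon> \<Longrightarrow> 0 \<le> \<delta> \<Longrightarrow> P \<epsilon> w w' \<Longrightarrow> P \<delta> w' w'' \<Longrightarrow> P (\<epsilon> + \<delta>) w w''"
  shows "P \<epsilon> w w'"
  using assms(2,3)
\<comment> \<open>The measure counts inverted pairs. Only the starting weight and the bound vary,
  since every cut keeps the far end \<open>w'\<close>.\<close>
proof (induction "card {(u, v). u \<in> U \<and> v \<in> U \<and> w u < w v \<and> w' v < w' u}" arbitrary: w \<epsilon> rule: less_induct)
  case less
  let ?I = "\<lambda>w. {(u, v). u \<in> U \<and> v \<in> U \<and> w u < w v \<and> w' v < w' u}"
  have fin: "finite (?I w)" for w
    by (rule finite_subset[of _ "U \<times> U"]) (use \<open>finite U\<close> in auto)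
  show ?case
  proof (cases "?I w = {}")
    case True
    show ?thesis
    proof (rule base[OF less.prems])
      show "w' u \<le> w' v" if "u \<in> U" "v \<in> U" "w u < w v" for u v
        using True that not_less by blast
    qed
  next
    case False
    \<comment> \<open>The parameter at which \<open>u\<close> and \<open>v\<close> get equal values
      on the segment, that is, the zero of the affine function given by \<open>m_diff\<close>
      below.\<close>
    define \<tau> where "\<tau> = (\<lambda>(u, v). (w v - w u) / ((w v - w u) + (w' u - w' v)))"
    define t where "t = Min (\<tau> ` ?I w)"
    have "t \<in> \<tau> ` ?I w" unfolding t_def using fin False by (intro Min_in) auto
    then obtain u0 v0 where uv0: "(u0, v0) \<in> ?I w" "t = \<tau> (u0, v0)" by blast
    have tmin: "t \<le> \<tau> x" if "x \<in> ?I w" for x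
      unfolding t_def using fin that by (intro Min_le) auto
    have "0 < w v0 - w u0" "0 < w' u0 - w' v0" using uv0(1) by auto
    then have t: "0 < t" "t < 1" unfolding uv0(2) \<tau>_def by simp_all
    define m where "m = (\<lambda>u. (1 - t) * w u + t * w' u)"
    have m_diff: "m v - m u = (1 - t) * (w v - w u) - t * (w' u - w' v)" for u v
      by (simp add: m_def algebra_simps)
    have first: "P (t * \<epsilon>) w m"
    proof (rule base)
      show "0 \<le> t * \<epsilon>" using t less.prems by simp
      show "\<bar>w u - m u\<bar> \<le> t * \<epsilon>" if "u \<in> U" for u
      proof -
        have "w u - m u = t * (w u - w' u)" by (simp add: m_def algebra_simps)
        then show ?thesis using less.prems(2)[OF that] t by (simp add: abs_mult)
      qed
      show "m u \<le> m v" if uv: "u \<in> U" "v \<in> U" "w u < w v" for u v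
      proof (cases "w' u \<le> w' v")
        case True
        have "0 \<le> (1 - t) * (w v - w u)" "t * (w' u - w' v) \<le> 0"
          using t uv True by (auto intro: mult_nonneg_nonneg mult_nonneg_nonpos)
        then show ?thesis using m_diff[of v u] by linarith
      next
        case False
        then have "t \<le> \<tau> (u, v)" using uv by (intro tmin) auto
        then have "t * ((w v - w u) + (w' u - w' v)) \<le> w v - w u"
          using uv False by (simp add: \<tau>_def pos_le_divide_eq)
        then show ?thesis using m_diff[of v u] by (simp add: algebra_simps)
      qed
    qed
    have second: "P ((1 - t) * \<epsilon>) m w'"
    proof (rule less.hyps)
      \<comment> \<open>Differences are affine along the segment, so a pair inverted between
        \<open>m\<close> and \<open>w'\<close> was already inverted between \<open>w\<close> and
        \<open>w'\<close>.\<close>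
      have sub: "?I m \<subseteq> ?I w"
      proof safe
        fix u v assume *: "m u < m v" "w' v < w' u"
        then have "0 < t * (w' u - w' v)" using t by simp
        then have "0 < (1 - t) * (w v - w u)" using m_diff[of v u] * by linarith
        then show "w u < w v" using t by (simp add: zero_less_mult_iff)
      qed
      \<comment> \<open>The pair that attains the minimum is tied at \<open>m\<close>, hence no
        longer inverted, and the measure drops.\<close>
      have "t * ((w v0 - w u0) + (w' u0 - w' v0)) = w v0 - w u0"
        using uv0 by (simp add: \<tau>_def)
      then have "m v0 - m u0 = 0" unfolding m_diff by (simp add: algebra_simps)
      then have "(u0, v0) \<notin> ?I m" by auto
      then have "?I m \<subset> ?I w" using sub uv0(1) by blast
      then show "card (?I m) < card (?I w)" by (rule psubset_card_mono[OF fin])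
      show "0 \<le> (1 - t) * \<epsilon>" using t less.prems by simp
      show "\<bar>m u - w' u\<bar> \<le> (1 - t) * \<epsilon>" if "u \<in> U" for u
      proof -
        have "m u - w' u = (1 - t) * (w u - w' u)" by (simp add: m_def algebra_simps)
        then show ?thesis using less.prems(2)[OF that] t by (simp add: abs_mult)
      qed
    qed
    have "P (t * \<epsilon> + (1 - t) * \<epsilon>) w w'"
      by (rule trans[OF _ _ first second]) (use t less.prems in auto)
    then show ?thesis by (simp add: algebra_simps)
  qed
qed

section \<open>Alternating chains\<close>

text \<open>Conditions on adjacent entries suit inductions along the list. The second clause does
  not follow from the first in characteristic 2.\<close>

definition alternating :: "('a list \<Rightarrow> 'k::field) \<Rightarrow> bool"
  where "alternating c \<longleftrightarrow> (\<forall>us x y vs. c (us @ x # y # vs) = - c (us @ y # x # vs)) \<and>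
    (\<forall>us x vs. c (us @ x # x # vs) = 0)"

lemma alternatingD:
  assumes "alternating c"
  shows alternating_adjacent: "c (us @ x # y # vs) = - c (us @ y # x # vs)"
    and alternating_twin: "c (us @ x # x # vs) = 0"
  using assms unfolding alternating_def by blast+

lemma alternating_swap:
  assumes "alternating c"
  shows "c (us @ x # ms @ y # vs) = - c (us @ y # ms @ x # vs)"
proof (induction ms arbitrary: us)
  case Nil
  then show ?case using alternating_adjacent[OF assms, of us x y vs] by simp
next
  case (Cons m ms)
  have "c (us @ x # m # ms @ y # vs) = - c ((us @ [m]) @ x # ms @ y # vs)"
    using alternating_adjacent[OF assms, of us x m] by simp
  also have "\<dots> = c (us @ m # y # ms @ x # vs)"
    unfolding Cons.IH by simp
  also have "\<dots> = - c (us @ y # m # ms @ x # vs)"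
    by (rule alternating_adjacent[OF assms])
  finally show ?case by simp
qed

lemma alternating_repeated:
  assumes "alternating c"
  shows "c (us @ x # ms @ x # vs) = 0"
proof (induction ms arbitrary: us)
  case Nil
  then show ?case using alternating_twin[OF assms] by simp
next
  case (Cons m ms)
  have "c (us @ x # m # ms @ x # vs) = - c ((us @ [m]) @ x # ms @ x # vs)"
    using alternating_adjacent[OF assms, of us x m] by simp
  then show ?case unfolding Cons.IH by simp
qed

text \<open>A transposition of entries decomposes into adjacent exchanges, odd in number, and an
  entry that occurs twice can be moved next to its copy, so distinctness comes from the second
  clause of \<open>alternating\<close>.\<close>

lemma chains_iff:
  "c \<in> chains S k \<longleftrightarrow> alternating c \<and> (\<forall>xs. c xs \<noteq> 0 \<longrightarrow> set xs \<in> S \<and> length xs = Suc k)"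
proof
  assume c: "c \<in> chains S k"
  have "alternating c"
    unfolding alternating_def
  proof (intro conjI allI)
    fix us vs :: "'a list" and x y
    let ?xs = "us @ y # x # vs" and ?i = "length us"
    have nth: "?xs ! ?i = y" "?xs ! Suc ?i = x"
      using nth_append_length[of "us @ [y]" x vs] by simp_all
    have "c (?xs[?i := ?xs ! Suc ?i, Suc ?i := ?xs ! ?i]) = - c ?xs"
      by (rule c[unfolded chains_def mem_Collect_eq, THEN conjunct2, rule_format]) simp
    then show "c (us @ x # y # vs) = - c (us @ y # x # vs)"
      unfolding nth by (simp add: list_update_append)
    show "c (us @ x # x # vs) = 0"
      using c by (force simp: chains_def)
  qed
  then show "alternating c \<and> (\<forall>xs. c xs \<noteq> 0 \<longrightarrow> set xs \<in> S \<and> length xs = Suc k)"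
    using c by (simp add: chains_def)
next
  assume *: "alternating c \<and> (\<forall>xs. c xs \<noteq> 0 \<longrightarrow> set xs \<in> S \<and> length xs = Suc k)"
  have "distinct xs" if "c xs \<noteq> 0" for xs
  proof (rule ccontr)
    assume "\<not> distinct xs"
    then obtain us x ms vs where "xs = us @ [x] @ ms @ [x] @ vs"
      using not_distinct_decomp by blast
    then show False using that alternating_repeated * by fastforce
  qed
  moreover have "c (xs[i := xs ! j, j := xs ! i]) = - c xs" if ij: "i < j" "j < length xs" for xs i j
  proof -
    define us ms vs where "us = take i xs" and "ms = take (j - Suc i) (drop (Suc i) xs)" and "vs = drop (Suc j) xs"
    have i: "i = length us" and j: "j = Suc (length us + length ms)"
      using ij by (simp_all add: us_def ms_def)
    have "xs = us @ xs ! i # drop (Suc i) xs"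
      using ij unfolding us_def by (intro id_take_nth_drop) simp
    also have "drop (Suc i) xs = ms @ xs ! j # vs"
      using id_take_nth_drop[of "j - Suc i" "drop (Suc i) xs"] ij by (simp add: ms_def vs_def)
    finally have xs: "xs = us @ xs ! i # ms @ xs ! j # vs" .
    define x y where "x = xs ! i" and "y = xs ! j"
    have xs': "xs = us @ x # ms @ y # vs" using xs by (simp add: x_def y_def)
    have "xs[i := y, j := x] = us @ y # ms @ x # vs"
      unfolding xs' i j by (simp add: list_update_append)
    moreover have "c (us @ y # ms @ x # vs) = - c (us @ x # ms @ y # vs)"
      by (rule alternating_swap) (use * in blast)
    ultimately show ?thesis by (simp add: x_def y_def flip: xs)
  qed
  ultimately show "c \<in> chains S k"
    using * by (auto simp: chains_def)
qed

lemma subspace_chains: "fs.subspace (chains S k :: ('a list \<Rightarrow> 'k::field) set)"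
proof (rule fs.subspaceI)
  show "0 \<in> chains S k" by (simp add: chains_iff alternating_def)
  fix c d :: "'a list \<Rightarrow> 'k" assume cd: "c \<in> chains S k" "d \<in> chains S k"
  then have alt: "alternating c" "alternating d" by (auto simp: chains_iff)
  have "alternating (c + d)"
    unfolding alternating_def
  proof (intro conjI allI)
    fix us x y vs
    show "(c + d) (us @ x # y # vs) = - (c + d) (us @ y # x # vs)"
      using alternating_adjacent[OF alt(1), of us x y vs] alternating_adjacent[OF alt(2), of us x y vs]
      by simp
    show "(c + d) (us @ x # x # vs) = 0"
      using alternating_twin[OF alt(1), of us x vs] alternating_twin[OF alt(2), of us x vs] by simp
  qed
  moreover have "c xs \<noteq> 0 \<or> d xs \<noteq> 0" if "(c + d) xs \<noteq> 0" for xs using that by auto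
  ultimately show "c + d \<in> chains S k" using cd unfolding chains_iff by blast
next
  fix r and c :: "'a list \<Rightarrow> 'k" assume c: "c \<in> chains S k"
  then have alt: "alternating c" by (simp add: chains_iff)
  have "alternating (fscale r c)"
    unfolding alternating_def
  proof (intro conjI allI)
    fix us x y vs
    show "r * c (us @ x # y # vs) = - (r * c (us @ y # x # vs))"
      using alternating_adjacent[OF alt, of us x y vs] by simp
    show "r * c (us @ x # x # vs) = 0"
      using alternating_twin[OF alt, of us x vs] by simp
  qed
  then show "fscale r c \<in> chains S k" using c by (simp add: chains_iff)
qed

lemma chains_mono: "S \<subseteq> S' \<Longrightarrow> chains S k \<subseteq> chains S' k"
  by (rule subsetI) (unfold chains_iff, blast)

text \<open>Unit functions are in general not chains; they bound the dimension of the space of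
  chains, so that adapted bases are finite.\<close>

lemma chains_subset_span:
  assumes "\<Union>S \<subseteq> V" "finite V"
  shows "chains S k \<subseteq> fs.span (unit_fun ` {xs. set xs \<subseteq> V \<and> length xs = Suc k} :: ('a list \<Rightarrow> 'k::field) set)"
proof
  fix c :: "'a list \<Rightarrow> 'k" assume "c \<in> chains S k"
  then show "c \<in> fs.span (unit_fun ` {xs. set xs \<subseteq> V \<and> length xs = Suc k})"
    using assms by (intro in_span_unit_fun) (auto simp: chains_iff finite_lists_length_eq)
qed

section \<open>Cycles and boundaries as subspaces of alternating chains\<close>

definition face_closed :: "'a set set \<Rightarrow> bool"
  where "face_closed S \<longleftrightarrow> (\<forall>\<sigma>\<in>S. \<forall>\<tau>\<subseteq>\<sigma>. \<tau> \<noteq> {} \<longrightarrow> \<tau> \<in> S)"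

text \<open>On chains, \<open>boundary S\<close> only depends on a vertex set containing \<open>\<Union>S\<close>, here \<open>V = \<Union>{V}\<close>.\<close>

lemma boundary_vertices:
  assumes "c \<in> chains S k" "\<Union>S \<subseteq> V" "finite V"
  shows "boundary S c = boundary {V} c"
proof
  fix ys
  have "(\<Sum>v\<in>\<Union>S. c (v # ys)) = (\<Sum>v\<in>V. c (v # ys))"
  proof (rule sum.mono_neutral_left[OF assms(3,2)])
    show "\<forall>v\<in>V - \<Union>S. c (v # ys) = 0"
      using assms(1) by (fastforce simp: chains_iff)
  qed
  then show "boundary S c ys = boundary {V} c ys" by (simp add: boundary_def)
qed

lemma boundary_add: "boundary S (c + d) = boundary S c + boundary S d"
  by (rule ext) (simp add: boundary_def sum.distrib)

lemma boundary_diff: "boundary S (c - d) = boundary S c - boundary S d"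
  by (rule ext) (simp add: boundary_def sum_subtractf)

lemma boundary_scale: "boundary S (fscale r c) = fscale r (boundary S c)"
  by (rule ext) (simp add: boundary_def sum_distrib_left)

lemma boundary_zero: "boundary S 0 = 0"
  by (rule ext) (simp add: boundary_def)

lemma boundary_in_chains:
  assumes c: "c \<in> chains S (Suc k)" and S: "face_closed S"
  shows "boundary {V} c \<in> chains S k"
  unfolding chains_iff
proof (intro conjI allI impI)
  have alt: "c (v # us @ x # y # vs) = - c (v # us @ y # x # vs)" "c (v # us @ x # x # vs) = 0" for v us x y vs
    using c alternating_adjacent[of c "v # us" x y vs] alternating_twin[of c "v # us" x vs]
    by (simp_all add: chains_iff)
  show "alternating (boundary {V} c)"
    unfolding alternating_def
  proof (intro conjI allI)
    fix us x y vs
    show "boundary {V} c (us @ x # y # vs) = - boundary {V} c (us @ y # x # vs)"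
      using alt(1)[of _ us x y vs] by (simp add: boundary_def sum_negf)
    show "boundary {V} c (us @ x # x # vs) = 0"
      using alt(2) by (simp add: boundary_def)
  qed
  fix ys assume "boundary {V} c ys \<noteq> 0"
  then obtain v where v: "ys \<noteq> []" "c (v # ys) \<noteq> 0"
    unfolding boundary_def by (metis sum.neutral)
  then have "set (v # ys) \<in> S" "length (v # ys) = Suc (Suc k)"
    using c unfolding chains_iff by blast+
  then show "set ys \<in> S" "length ys = Suc k"
    using S v(1) unfolding face_closed_def by auto
qed

text \<open>Off-diagonal terms cancel in pairs. In characteristic 2 antisymmetry says nothing about
  the diagonal, hence the last assumption.\<close>

lemma sum_antisymmetric:
  fixes f :: "'a \<Rightarrow> 'a \<Rightarrow> 'k::ab_group_add"
  assumes "finite V" "\<And>u v. f u v = - f v u" "\<And>u. f u u = 0"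
  shows "(\<Sum>u\<in>V. \<Sum>v\<in>V. f u v) = 0"
  using assms(1)
proof induction
  case (insert x V)
  have "(\<Sum>u\<in>V. f u x) = - (\<Sum>v\<in>V. f x v)"
    unfolding sum_negf[symmetric] by (rule sum.cong[OF refl assms(2)])
  then show ?case using insert.hyps insert.IH assms(3) by (simp add: sum.distrib)
qed simp

text \<open>The double contraction sums \<open>c (v # u # ys)\<close> over all \<open>u\<close> and
  \<open>v\<close>, and this is antisymmetric in the two vertices.\<close>

lemma boundary_boundary:
  assumes "c \<in> chains S k" "finite V"
  shows "boundary {V} (boundary {V} c) = 0"
proof
  fix ys
  have "(\<Sum>u\<in>V. \<Sum>v\<in>V. c (v # u # ys)) = 0"
  proof (rule sum_antisymmetric[OF assms(2)])
    have "alternating c" using assms(1) by (simp add: chains_iff)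
    then show "c (v # u # ys) = - c (u # v # ys)" "c (u # u # ys) = 0" for u v
      using alternating_adjacent[of c "[]" v u ys] alternating_twin[of c "[]" u ys] by simp_all
  qed
  then show "boundary {V} (boundary {V} c) ys = 0 ys" by (simp add: boundary_def)
qed

lemma cycles_vertices:
  assumes "\<Union>S \<subseteq> V" "finite V"
  shows "cycles S k = {c \<in> chains S k. boundary {V} c = 0}"
  by (auto simp: cycles_def boundary_vertices[OF _ assms])

lemma boundaries_vertices:
  assumes "\<Union>S \<subseteq> V" "finite V"
  shows "boundaries S k = boundary {V} ` chains S (Suc k)"
  unfolding boundaries_def by (rule image_cong[OF refl boundary_vertices[OF _ assms]])

lemma subspace_cycles:
  assumes "\<Union>S \<subseteq> V" "finite V"
  shows "fs.subspace (cycles S k :: ('a list \<Rightarrow> 'k::field) set)"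
  unfolding cycles_vertices[OF assms]
proof (rule fs.subspaceI)
  show "0 \<in> {c \<in> chains S k. boundary {V} c = 0}"
    using fs.subspace_0[OF subspace_chains] by (simp add: boundary_zero)
qed (auto simp: boundary_add boundary_scale zero_fun_def fs.subspace_add[OF subspace_chains] intro: fs.subspace_scale[OF subspace_chains])

lemma subspace_boundaries:
  assumes "\<Union>S \<subseteq> V" "finite V"
  shows "fs.subspace (boundaries S k :: ('a list \<Rightarrow> 'k::field) set)"
  unfolding boundaries_vertices[OF assms]
proof (rule fs.subspaceI)
  show "0 \<in> boundary {V} ` chains S (Suc k)"
    by (rule image_eqI[where x = 0]) (simp_all add: boundary_zero fs.subspace_0[OF subspace_chains])
qed (auto simp flip: boundary_add boundary_scale intro!: imageI intro: fs.subspace_scale[OF subspace_chains] fs.subspace_add[OF subspace_chains])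

lemma boundaries_subset_cycles:
  assumes "\<Union>S \<subseteq> V" "finite V" "face_closed S"
  shows "boundaries S k \<subseteq> cycles S k"
  unfolding cycles_vertices[OF assms(1,2)] boundaries_vertices[OF assms(1,2)]
  using boundary_in_chains[OF _ assms(3)] boundary_boundary[OF _ assms(2)] by blast

lemma cycles_mono:
  assumes "S \<subseteq> S'" "\<Union>S' \<subseteq> V" "finite V"
  shows "cycles S k \<subseteq> cycles S' k"
proof -
  have V: "\<Union>S \<subseteq> V" using assms by blast
  show ?thesis
    unfolding cycles_vertices[OF V assms(3)] cycles_vertices[OF assms(2,3)]
    using chains_mono[OF assms(1)] by blast
qed

lemma boundaries_mono:
  assumes "S \<subseteq> S'" "\<Union>S' \<subseteq> V" "finite V"
  shows "boundaries S k \<subseteq> boundaries S' k"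
proof -
  have V: "\<Union>S \<subseteq> V" using assms by blast
  show ?thesis
    unfolding boundaries_vertices[OF V assms(3)] boundaries_vertices[OF assms(2,3)]
    by (rule image_mono[OF chains_mono[OF assms(1)]])
qed

lemma persistent_homology_quotient:
  "persistent_homology F k = quotient_pv (\<lambda>t. cycles (F t) k) (\<lambda>t. boundaries (F t) k)"
  by (simp add: persistent_homology_def quotient_pv_def homology_def)

lemma persistent_subspaces_homology:
  assumes "finite V" "\<And>t. \<Union>(F t) \<subseteq> V" "\<And>t. face_closed (F t)" "\<And>s t. s \<le> t \<Longrightarrow> F s \<subseteq> F t"
  shows "persistent_subspaces (\<lambda>t. cycles (F t) k) (\<lambda>t. boundaries (F t) k :: ('a list \<Rightarrow> 'k::field) set)"
proof
  show "fs.subspace (cycles (F t) k :: ('a list \<Rightarrow> 'k) set)" for t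
    by (rule subspace_cycles[OF assms(2,1)])
  show "fs.subspace (boundaries (F t) k :: ('a list \<Rightarrow> 'k) set)" for t
    by (rule subspace_boundaries[OF assms(2,1)])
  show "boundaries (F t) k \<subseteq> (cycles (F t) k :: ('a list \<Rightarrow> 'k) set)" for t
    by (rule boundaries_subset_cycles[OF assms(2,1,3)])
  show "cycles (F s) k \<subseteq> (cycles (F t) k :: ('a list \<Rightarrow> 'k) set)" if "s \<le> t" for s t
    by (rule cycles_mono[OF assms(4)[OF that] assms(2,1)])
  show "boundaries (F s) k \<subseteq> (boundaries (F t) k :: ('a list \<Rightarrow> 'k) set)" if "s \<le> t" for s t
    by (rule boundaries_mono[OF assms(4)[OF that] assms(2,1)])
qed

section \<open>Pullback of a complex along a surjection of the vertices\<close>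

text \<open>
  In the description of chains as alternating forms, \<open>boundary\<close> is the contraction with the constant
  form 1 and \<open>wedge a\<close>, the exterior product with the dual of \<open>a\<close>, is the cone with apex \<open>a\<close>.
\<close>

fun wedge :: "'a \<Rightarrow> ('a list \<Rightarrow> 'k::field) \<Rightarrow> 'a list \<Rightarrow> 'k"
  where
    "wedge a c [] = 0"
  | "wedge a c (x # xs) = (if x = a then c xs else 0) - wedge a (\<lambda>ys. c (x # ys)) xs"

lemma wedge_uminus: "wedge a (\<lambda>ys. - c ys) xs = - wedge a c xs"
  by (induction a c xs rule: wedge.induct) simp_all

lemma wedge_zero: "wedge a (\<lambda>ys. 0) xs = 0"
  by (induction xs) simp_all

lemma wedge_sum: "finite V \<Longrightarrow> wedge a (\<lambda>ys. \<Sum>v\<in>V. c v ys) xs = (\<Sum>v\<in>V. wedge a (c v) xs)"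
  by (induction xs arbitrary: c) (auto simp: sum_subtractf)

lemma wedge_nonzeroE:
  assumes "wedge a c xs \<noteq> 0"
  obtains us vs where "xs = us @ a # vs" "c (us @ vs) \<noteq> 0"
  using assms
proof (induction a c xs arbitrary: thesis rule: wedge.induct)
  case (2 a c x xs)
  show ?case
  proof (cases "x = a \<and> c xs \<noteq> 0")
    case True
    then show ?thesis using "2.prems"(1)[of "[]" xs] by simp
  next
    case False
    then have "wedge a (\<lambda>ys. c (x # ys)) xs \<noteq> 0" using "2.prems"(2) by (auto split: if_splits)
    then obtain us vs where "xs = us @ a # vs" "c (x # us @ vs) \<noteq> 0"
      using "2.IH" by blast
    then show ?thesis using "2.prems"(1)[of "x # us" vs] by simp
  qed
qed simp

lemma alternating_Cons:
  assumes "alternating c"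
  shows "alternating (\<lambda>ys. c (x # ys))"
  unfolding alternating_def
proof (intro conjI allI)
  fix us u v vs
  show "c (x # us @ u # v # vs) = - c (x # us @ v # u # vs)"
    using alternating_adjacent[OF assms, of "x # us" u v vs] by simp
  show "c (x # us @ u # u # vs) = 0"
    using alternating_twin[OF assms, of "x # us" u vs] by simp
qed

lemma alternating_wedge:
  assumes "alternating c"
  shows "alternating (wedge a c)"
  unfolding alternating_def
proof (intro conjI allI)
  fix us x y vs
  show "wedge a c (us @ x # y # vs) = - wedge a c (us @ y # x # vs)"
    using assms
  proof (induction us arbitrary: c)
    case Nil
    have "(\<lambda>zs. c (x # y # zs)) = (\<lambda>zs. - c (y # x # zs))"
      using alternating_adjacent[OF Nil, of "[]" x y] by simp
    then show ?case by (simp add: wedge_uminus)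
  next
    case (Cons u us)
    show ?case
      using Cons.IH[OF alternating_Cons[OF Cons.prems, of u]]
        alternating_adjacent[OF Cons.prems, of us x y vs] by simp
  qed
  show "wedge a c (us @ x # x # vs) = 0"
    using assms
  proof (induction us arbitrary: c)
    case Nil
    have "(\<lambda>zs. c (x # x # zs)) = (\<lambda>zs. 0)"
      using alternating_twin[OF Nil, of "[]" x] by simp
    then show ?case by (simp add: wedge_zero)
  next
    case (Cons u us)
    show ?case
      using Cons.IH[OF alternating_Cons[OF Cons.prems, of u]]
        alternating_twin[OF Cons.prems, of us x vs] by simp
  qed
qed

text \<open>Contraction is an antiderivation, and it sends the dual of \<open>a \<in> V\<close> to
  1. This is the formula that makes the cone with apex \<open>a\<close> a chain homotopy.\<close>

lemma contract_wedge:
  assumes "finite V" "a \<in> V"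
  shows "(\<Sum>v\<in>V. wedge a c (v # ys)) = c ys - wedge a (\<lambda>zs. \<Sum>v\<in>V. c (v # zs)) ys"
  using assms by (simp add: sum_subtractf wedge_sum)

text \<open>The part \<open>dz\<close> of \<open>d\<close> at \<open>z\<close> is coned off with
  apex \<open>a\<close>; the cone stays in \<open>K\<close> because \<open>a\<close> dominates
  \<open>z\<close>. Subtracting its boundary cancels \<open>dz\<close> up to a cone over the
  boundary of \<open>dz\<close>, which vanishes at lists through \<open>z\<close> by the assumption
  on \<open>d\<close>. That assumption is weaker than being a cycle, as the injectivity argument on
  homology requires.\<close>

lemma push_off_vertex:
  assumes K: "face_closed K" "\<Union>K \<subseteq> V" "finite V"
    and a: "a \<in> V" "a \<noteq> z" "\<And>\<sigma>. \<sigma> \<in> K \<Longrightarrow> z \<in> \<sigma> \<Longrightarrow> insert a \<sigma> \<in> K"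
    and d: "d \<in> chains K m" "\<And>ys. z \<in> set ys \<Longrightarrow> boundary {V} d ys = 0"
  shows "\<exists>e\<in>chains K (Suc m). d - boundary {V} e \<in> chains {\<sigma>\<in>K. z \<notin> \<sigma>} m"
proof
  define dz where "dz = (\<lambda>ys. if z \<in> set ys then d ys else 0)"
  define e where "e = wedge a dz"
  have alt: "alternating d" using d(1) by (simp add: chains_iff)
  have "alternating dz"
    unfolding alternating_def
  proof (intro conjI allI)
    fix us x y vs
    show "dz (us @ x # y # vs) = - dz (us @ y # x # vs)"
      using alternating_adjacent[OF alt, of us x y vs] by (auto simp: dz_def)
    show "dz (us @ x # x # vs) = 0"
      using alternating_twin[OF alt, of us x vs] by (simp add: dz_def)
  qed
  then have "alternating e" unfolding e_def by (rule alternating_wedge)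
  moreover have "set xs \<in> K \<and> length xs = Suc (Suc m)" if nz: "e xs \<noteq> 0" for xs
  proof -
    obtain us vs where xs: "xs = us @ a # vs" "dz (us @ vs) \<noteq> 0"
      using nz unfolding e_def by (rule wedge_nonzeroE)
    then have "z \<in> set (us @ vs)" "d (us @ vs) \<noteq> 0"
      unfolding dz_def by presburger+
    moreover from this have "set (us @ vs) \<in> K" "length (us @ vs) = Suc m"
      using d(1) unfolding chains_iff by blast+
    ultimately have "insert a (set (us @ vs)) \<in> K" using a(3) by blast
    then show ?thesis using xs(1) \<open>length (us @ vs) = Suc m\<close> by simp
  qed
  ultimately show e: "e \<in> chains K (Suc m)" unfolding chains_iff by blast
  have de: "d - boundary {V} e \<in> chains K m"
    by (rule fs.subspace_diff[OF subspace_chains d(1) boundary_in_chains[OF e K(1)]])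
  have "(d - boundary {V} e) ys = 0" if z: "z \<in> set ys" for ys
  proof (rule ccontr)
    assume nz: "(d - boundary {V} e) ys \<noteq> 0"
    have "boundary {V} e ys = d ys - wedge a (\<lambda>zs. \<Sum>v\<in>V. dz (v # zs)) ys"
      using z contract_wedge[OF K(3) a(1), of dz ys] by (auto simp: boundary_def e_def dz_def)
    then have "wedge a (\<lambda>zs. \<Sum>v\<in>V. dz (v # zs)) ys \<noteq> 0" using nz by auto
    then obtain us vs where ys: "ys = us @ a # vs" "(\<Sum>v\<in>V. dz (v # us @ vs)) \<noteq> 0"
      by (rule wedge_nonzeroE)
    \<comment> \<open>As \<open>a \<noteq> z\<close>, deleting \<open>a\<close> keeps
      \<open>z\<close> in the list. Hence \<open>dz\<close> agrees with \<open>d\<close> on all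
      terms of the sum, and the list is not empty, as \<open>boundary\<close> demands.\<close>
    then have z': "z \<in> set (us @ vs)" using z a(2) by auto
    then have "(\<Sum>v\<in>V. dz (v # us @ vs)) = boundary {V} d (us @ vs)"
      by (auto simp: boundary_def dz_def)
    then show False using ys(2) d(2)[OF z'] by simp
  qed
  then show "d - boundary {V} e \<in> chains {\<sigma>\<in>K. z \<notin> \<sigma>} m"
    using de unfolding chains_iff by blast
qed

text \<open>The vertices outside \<open>A\<close> are removed one at a time. Their apexes lie in
  \<open>A\<close> and are never removed, so the subcomplex avoiding \<open>W\<close> inherits the
  domination; the boundary of \<open>d\<close> is unchanged because boundaries are cycles.\<close>

lemma push_off:
  assumes K: "face_closed K" "\<Union>K \<subseteq> V" "finite V" and A: "A \<subseteq> V"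
    and dom: "\<And>z. z \<in> V - A \<Longrightarrow> \<exists>a\<in>A. \<forall>\<sigma>\<in>K. z \<in> \<sigma> \<longrightarrow> insert a \<sigma> \<in> K"
    and d: "d \<in> chains K m" "\<And>ys. \<not> set ys \<subseteq> A \<Longrightarrow> boundary {V} d ys = 0"
  shows "\<exists>e\<in>chains K (Suc m). d - boundary {V} e \<in> chains {\<sigma>\<in>K. \<sigma> \<subseteq> A} m"
proof -
  have "\<exists>e\<in>chains K (Suc m). d - boundary {V} e \<in> chains {\<sigma>\<in>K. \<sigma> \<inter> W = {}} m"
    if "finite W" "W \<subseteq> V - A" for W
    using that
  proof induction
    case empty
    show ?case
    proof
      have "d - boundary {V} 0 = d" unfolding boundary_zero by simp
      then show "d - boundary {V} 0 \<in> chains {\<sigma>\<in>K. \<sigma> \<inter> {} = {}} m" using d(1) by simp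
    qed (rule fs.subspace_0[OF subspace_chains])
  next
    case (insert z W)
    let ?K = "{\<sigma>\<in>K. \<sigma> \<inter> W = {}}"
    obtain e where e: "e \<in> chains K (Suc m)" "d - boundary {V} e \<in> chains ?K m"
      using insert.IH insert.prems by blast
    obtain a where a: "a \<in> A" "\<forall>\<sigma>\<in>K. z \<in> \<sigma> \<longrightarrow> insert a \<sigma> \<in> K"
      using dom insert.prems by blast
    have "\<exists>f\<in>chains ?K (Suc m). (d - boundary {V} e) - boundary {V} f \<in> chains {\<sigma>\<in>?K. z \<notin> \<sigma>} m"
    proof (rule push_off_vertex[OF _ _ K(3) _ _ _ e(2)])
      show "face_closed ?K" using K(1) unfolding face_closed_def by blast
      show "\<Union>?K \<subseteq> V" using K(2) by blast
      show "a \<in> V" "a \<noteq> z" using a(1) A insert.prems by auto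
      show "insert a \<sigma> \<in> ?K" if "\<sigma> \<in> ?K" "z \<in> \<sigma>" for \<sigma>
        using that a insert.prems by blast
      fix ys assume "z \<in> set ys"
      then have "\<not> set ys \<subseteq> A" using insert.prems by blast
      then show "boundary {V} (d - boundary {V} e) ys = 0"
        using d(2) boundary_boundary[OF e(1) K(3)] by (simp add: boundary_diff)
    qed
    then obtain f where f: "f \<in> chains ?K (Suc m)"
        "d - boundary {V} e - boundary {V} f \<in> chains {\<sigma>\<in>?K. z \<notin> \<sigma>} m" by blast
    have "f \<in> chains K (Suc m)" using f(1) chains_mono[of ?K K] by blast
    then have ef: "e + f \<in> chains K (Suc m)" using e(1) by (intro fs.subspace_add[OF subspace_chains])
    have K_eq: "{\<sigma>\<in>?K. z \<notin> \<sigma>} = {\<sigma>\<in>K. \<sigma> \<inter> insert z W = {}}" by blast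
    have "d - boundary {V} (e + f) = d - boundary {V} e - boundary {V} f"
      by (simp add: boundary_add diff_diff_eq)
    then have "d - boundary {V} (e + f) \<in> chains {\<sigma>\<in>K. \<sigma> \<inter> insert z W = {}} m"
      using f(2) unfolding K_eq by (simp only:)
    then show ?case using ef by (rule bexI)
  qed
  from this[of "V - A"] obtain e where e: "e \<in> chains K (Suc m)"
      "d - boundary {V} e \<in> chains {\<sigma>\<in>K. \<sigma> \<inter> (V - A) = {}} m"
    using K(3) by auto
  have "{\<sigma>\<in>K. \<sigma> \<inter> (V - A) = {}} \<subseteq> {\<sigma>\<in>K. \<sigma> \<subseteq> A}" using K(2) by blast
  then show ?thesis using e chains_mono by blast
qed

section \<open>Comparison of a complex with its pullback through a section\<close>

definition pullback_complex :: "('b \<Rightarrow> 'a) \<Rightarrow> 'b set \<Rightarrow> 'a set set \<Rightarrow> 'b set set"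
  where "pullback_complex p V K = {\<sigma>. \<sigma> \<subseteq> V \<and> \<sigma> \<noteq> {} \<and> p ` \<sigma> \<in> K}"

locale vertex_section =
  fixes X :: "'a set" and V :: "'b set" and p :: "'b \<Rightarrow> 'a" and s :: "'a \<Rightarrow> 'b"
  assumes finite_V: "finite V" and p_V: "p ` V \<subseteq> X"
    and s_X: "s ` X \<subseteq> V" and p_s: "x \<in> X \<Longrightarrow> p (s x) = x"
begin

lemma finite_X: "finite X"
proof -
  have "X \<subseteq> p ` V" using s_X p_s by force
  then show ?thesis using finite_V finite_surj by blast
qed

lemma s_p: "v \<in> s ` X \<Longrightarrow> s (p v) = v"
  using p_s by auto

text \<open>The chain map induced by the injection \<open>s\<close>. Since chains are functions, it
  is written as composition with \<open>p\<close> on lists of section vertices and as 0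
  elsewhere.\<close>

definition extend :: "('a list \<Rightarrow> 'k::field) \<Rightarrow> 'b list \<Rightarrow> 'k"
  where "extend c zs = (if set zs \<subseteq> s ` X then c (map p zs) else 0)"

lemma extend_add: "extend (c + d) = extend c + extend d"
  by (rule ext) (simp add: extend_def)

lemma extend_diff: "extend (c - d) = extend c - extend d"
  by (rule ext) (simp add: extend_def)

lemma extend_scale: "extend (fscale r c) = fscale r (extend c)"
  by (rule ext) (simp add: extend_def)

lemma boundary_extend: "boundary {V} (extend c) = extend (boundary {X} c)"
proof
  fix zs
  have "(\<Sum>v\<in>V. extend c (v # zs)) = (\<Sum>x\<in>X. c (x # map p zs))" if zs: "set zs \<subseteq> s ` X"
  proof -
    have "(\<Sum>v\<in>V. extend c (v # zs)) = (\<Sum>v\<in>s ` X. extend c (v # zs))"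
      by (rule sum.mono_neutral_right[OF finite_V s_X]) (auto simp: extend_def)
    also have "\<dots> = (\<Sum>x\<in>X. extend c (s x # zs))"
      by (rule sum.reindex_cong[of s]) (auto intro!: inj_on_inverseI[of _ p] p_s)
    also have "\<dots> = (\<Sum>x\<in>X. c (x # map p zs))"
      using zs by (intro sum.cong) (auto simp: extend_def p_s)
    finally show ?thesis .
  qed
  moreover have "(\<Sum>v\<in>V. extend c (v # zs)) = 0" if "\<not> set zs \<subseteq> s ` X"
    using that by (simp add: extend_def)
  ultimately show "boundary {V} (extend c) zs = extend (boundary {X} c) zs"
    by (auto simp: boundary_def extend_def)
qed

lemma extend_chains:
  assumes "c \<in> chains K m"
  shows "extend c \<in> chains (pullback_complex p V K) m"
  unfolding chains_iff
proof (intro conjI allI impI)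
  have alt: "alternating c" using assms by (simp add: chains_iff)
  show "alternating (extend c)"
    unfolding alternating_def
  proof (intro conjI allI)
    fix us x y vs
    show "extend c (us @ x # y # vs) = - extend c (us @ y # x # vs)"
      using alternating_adjacent[OF alt, of "map p us" "p x" "p y" "map p vs"] by (auto simp: extend_def)
    show "extend c (us @ x # x # vs) = 0"
      using alternating_twin[OF alt, of "map p us" "p x" "map p vs"] by (auto simp: extend_def)
  qed
  fix zs assume "extend c zs \<noteq> 0"
  then have zs: "set zs \<subseteq> s ` X" "c (map p zs) \<noteq> 0" by (auto simp: extend_def split: if_splits)
  then have *: "set (map p zs) \<in> K" "length (map p zs) = Suc m"
    using assms unfolding chains_iff by blast+
  then have "zs \<noteq> []" by auto
  then show "set zs \<in> pullback_complex p V K" "length zs = Suc m"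
    using zs s_X * by (auto simp: pullback_complex_def)
qed

lemma extend_inject:
  assumes "c \<in> chains K m" "c' \<in> chains K m" "\<Union>K \<subseteq> X" "extend c = extend c'"
  shows "c = c'"
proof
  fix xs
  show "c xs = c' xs"
  proof (cases "set xs \<subseteq> X")
    case True
    then have xs: "map p (map s xs) = xs" using p_s by (intro nth_equalityI) (auto dest: nth_mem)
    have "c (map p (map s xs)) = c' (map p (map s xs))"
      using fun_cong[OF assms(4), of "map s xs"] True by (simp add: extend_def image_mono)
    then show ?thesis unfolding xs .
  next
    case False
    then have "set xs \<notin> K" using assms(3) by blast
    then show ?thesis using assms(1,2) unfolding chains_iff by metis
  qed
qed

lemma extend_surj:
  assumes "d \<in> chains {\<sigma> \<in> pullback_complex p V K. \<sigma> \<subseteq> s ` X} m"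
  shows "\<exists>c\<in>chains K m. extend c = d"
proof
  let ?c = "\<lambda>xs. if set xs \<subseteq> X then d (map s xs) else 0"
  have alt: "alternating d" using assms by (simp add: chains_iff)
  show "?c \<in> chains K m"
    unfolding chains_iff
  proof (intro conjI allI impI)
    show "alternating ?c"
      unfolding alternating_def
    proof (intro conjI allI)
      fix us x y vs
      show "?c (us @ x # y # vs) = - ?c (us @ y # x # vs)"
        using alternating_adjacent[OF alt, of "map s us" "s x" "s y" "map s vs"] by auto
      show "?c (us @ x # x # vs) = 0"
        using alternating_twin[OF alt, of "map s us" "s x" "map s vs"] by auto
    qed
    fix xs assume "?c xs \<noteq> 0"
    then have xs: "set xs \<subseteq> X" "d (map s xs) \<noteq> 0" by (auto split: if_splits)
    then have *: "set (map s xs) \<in> pullback_complex p V K" "length (map s xs) = Suc m"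
      using assms unfolding chains_iff by blast+
    have "p ` s ` set xs = set xs" using xs(1) p_s by (force simp: image_iff)
    then show "set xs \<in> K" "length xs = Suc m" using * by (auto simp: pullback_complex_def)
  qed
  show "extend ?c = d"
  proof
    fix zs
    show "extend ?c zs = d zs"
    proof (cases "set zs \<subseteq> s ` X")
      case True
      then have "map s (map p zs) = zs" using s_p by (intro nth_equalityI) (auto dest: nth_mem)
      moreover have "p ` set zs \<subseteq> X" using True s_X p_V by blast
      ultimately show ?thesis using True by (simp add: extend_def)
    next
      case False
      then have "d zs = 0" using assms unfolding chains_iff by blast
      then show ?thesis using False by (simp add: extend_def)
    qed
  qed
qed

lemma face_closed_pullback:
  assumes "face_closed K"
  shows "face_closed (pullback_complex p V K)"
  unfolding face_closed_def
proof (intro ballI allI impI)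
  fix \<sigma> \<tau> assume *: "\<sigma> \<in> pullback_complex p V K" "\<tau> \<subseteq> \<sigma>" "\<tau> \<noteq> {}"
  then have "p ` \<sigma> \<in> K" "p ` \<tau> \<subseteq> p ` \<sigma>" "p ` \<tau> \<noteq> {}"
    by (auto simp: pullback_complex_def)
  then have "p ` \<tau> \<in> K" using assms unfolding face_closed_def by blast
  then show "\<tau> \<in> pullback_complex p V K" using * by (auto simp: pullback_complex_def)
qed

text \<open>The vertices \<open>z\<close> and \<open>s (p z)\<close> have the same image, so adding
  the second to a simplex containing the first stays in the pullback. The case of boundary zero
  gives surjectivity on homology, that of a nonzero extended boundary gives injectivity.\<close>

lemma pullback_push_off:
  assumes K: "face_closed K" "\<Union>K \<subseteq> X"
    and d: "d \<in> chains (pullback_complex p V K) m" "boundary {V} d = extend c"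
  shows "\<exists>c'\<in>chains K m. \<exists>e\<in>chains (pullback_complex p V K) (Suc m). d = extend c' + boundary {V} e"
proof -
  have "\<exists>e\<in>chains (pullback_complex p V K) (Suc m).
      d - boundary {V} e \<in> chains {\<sigma> \<in> pullback_complex p V K. \<sigma> \<subseteq> s ` X} m"
  proof (rule push_off[OF _ _ finite_V s_X _ d(1)])
    show "face_closed (pullback_complex p V K)"
      by (rule face_closed_pullback[OF K(1)])
    show "\<Union>(pullback_complex p V K) \<subseteq> V" by (auto simp: pullback_complex_def)
    show "\<exists>a\<in>s ` X. \<forall>\<sigma>\<in>pullback_complex p V K. z \<in> \<sigma> \<longrightarrow> insert a \<sigma> \<in> pullback_complex p V K"
      if "z \<in> V - s ` X" for z
    proof (intro bexI ballI impI)
      have z: "p z \<in> X" using that p_V by blast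
      then show "s (p z) \<in> s ` X" by blast
      fix \<sigma> assume \<sigma>: "\<sigma> \<in> pullback_complex p V K" "z \<in> \<sigma>"
      have "p ` insert (s (p z)) \<sigma> = p ` \<sigma>"
        using p_s[OF z] \<sigma>(2) by auto
      then show "insert (s (p z)) \<sigma> \<in> pullback_complex p V K"
        using \<sigma> z s_X unfolding pullback_complex_def by auto
    qed
    show "boundary {V} d ys = 0" if "\<not> set ys \<subseteq> s ` X" for ys
      using that by (simp add: d(2) extend_def)
  qed
  then obtain e where e: "e \<in> chains (pullback_complex p V K) (Suc m)"
      "d - boundary {V} e \<in> chains {\<sigma> \<in> pullback_complex p V K. \<sigma> \<subseteq> s ` X} m" by blast
  obtain c' where "c' \<in> chains K m" "extend c' = d - boundary {V} e"
    using extend_surj[OF e(2)] by blast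
  then show ?thesis using e(1) by (metis diff_add_cancel)
qed

lemma pullback_isomorphic:
  assumes F: "\<And>t. \<Union>(F t) \<subseteq> X" "\<And>t. face_closed (F t)" "\<And>s t. s \<le> t \<Longrightarrow> F s \<subseteq> F t"
  shows "pv_isomorphic (persistent_homology F k :: ('k::field, ('a list \<Rightarrow> 'k) set) persistence_vs)
    (persistent_homology (\<lambda>t. pullback_complex p V (F t)) k :: ('k, ('b list \<Rightarrow> 'k) set) persistence_vs)"
proof -
  define G where "G = (\<lambda>t. pullback_complex p V (F t))"
  have G: "\<Union>(G t) \<subseteq> V" "face_closed (G t)" "s \<le> t \<Longrightarrow> G s \<subseteq> G t" for s t
    using face_closed_pullback[OF F(2)] F(3) by (auto simp: G_def pullback_complex_def)
  interpret F: persistent_subspaces "\<lambda>t. cycles (F t) k" "\<lambda>t. boundaries (F t) k :: ('a list \<Rightarrow> 'k) set"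
    by (rule persistent_subspaces_homology[OF finite_X F])
  interpret G: persistent_subspaces "\<lambda>t. cycles (G t) k" "\<lambda>t. boundaries (G t) k :: ('b list \<Rightarrow> 'k) set"
    by (rule persistent_subspaces_homology[OF finite_V G])
  note vF = cycles_vertices[OF F(1) finite_X] boundaries_vertices[OF F(1) finite_X]
  note vG = cycles_vertices[OF G(1) finite_V] boundaries_vertices[OF G(1) finite_V]
  have ext0: "extend (0 :: 'a list \<Rightarrow> 'k) = 0" by (simp add: extend_def fun_eq_iff)
  have ext: "extend c \<in> chains (G t) m" if "c \<in> chains (F t) m" for c :: "'a list \<Rightarrow> 'k" and t m
    unfolding G_def by (rule extend_chains[OF that])
  have push: "\<exists>c'\<in>chains (F t) m. \<exists>e\<in>chains (G t) (Suc m). d = extend c' + boundary {V} e"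
    if "d \<in> chains (G t) m" "boundary {V} d = extend c" for d :: "'b list \<Rightarrow> 'k" and c t m
    using pullback_push_off[OF F(2,1)] that unfolding G_def by blast
  have ext_cycle: "extend x \<in> cycles (G t) k" if "x \<in> cycles (F t) k" for x :: "'a list \<Rightarrow> 'k" and t
    using that ext unfolding vF vG by (simp add: boundary_extend ext0)
  have "pv_isomorphic (quotient_pv (\<lambda>t. cycles (F t) k) (\<lambda>t. boundaries (F t) k :: ('a list \<Rightarrow> 'k) set))
    (quotient_pv (\<lambda>t. cycles (G t) k) (\<lambda>t. boundaries (G t) k :: ('b list \<Rightarrow> 'k) set))" (is "pv_isomorphic _ ?W")
  proof (rule F.quotient_isomorphicI[where L = "\<lambda>t c. extend c +o boundaries (G t) k"])
    show "(\<lambda>c. extend c +o boundaries (G t) k) ` cycles (F t) k = pv_space ?W t" for t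
    proof
      show "(\<lambda>c. extend c +o boundaries (G t) k) ` cycles (F t) k \<subseteq> pv_space ?W t"
        using ext_cycle by (auto simp: quotient_pv_def)
      show "pv_space ?W t \<subseteq> (\<lambda>c. extend c +o boundaries (G t) k) ` cycles (F t) k"
      proof
        fix A assume "A \<in> pv_space ?W t"
        then obtain z where z: "z \<in> cycles (G t) k" "A = z +o boundaries (G t) k"
          by (auto simp: quotient_pv_def)
        then have "z \<in> chains (G t) k" "boundary {V} z = extend 0"
          unfolding vG by (simp_all add: ext0)
        then obtain c e where ce: "c \<in> chains (F t) k" "e \<in> chains (G t) (Suc k)" "z = extend c + boundary {V} e"
          using push by blast
        have "extend (boundary {X} c) = 0"
        proof -
          have "boundary {V} (extend c + boundary {V} e) = 0" using z(1) ce(3) by (simp add: vG)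
          then show ?thesis
            using boundary_boundary[OF ce(2) finite_V] by (simp add: boundary_add boundary_extend)
        qed
        have "boundary {X} c = 0"
        \<comment> \<open>The boundary of \<open>c\<close> is a chain, to which
          \<open>extend_inject\<close> applies, only in positive degree; on 0-chains it is zero
          because their support consists of lists of length 1.\<close>
        proof (cases k)
          case 0
          have "boundary {X} c ys = 0" for ys
            using ce(1) 0 unfolding boundary_def chains_iff by (auto intro!: sum.neutral)
          then show ?thesis by (simp add: fun_eq_iff)
        next
          case (Suc m)
          then have "boundary {X} c \<in> chains (F t) m"
            using boundary_in_chains[OF _ F(2)] ce(1) by blast
          then show ?thesis
            using extend_inject[OF _ fs.subspace_0[OF subspace_chains] F(1)]
              \<open>extend (boundary {X} c) = 0\<close> ext0 by metis
        qed
        then have "c \<in> cycles (F t) k" using ce(1) by (simp add: vF)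
        moreover have "A = extend c +o boundaries (G t) k"
          unfolding z(2) G.coset_eq_iff using ce(2,3) by (auto simp: vG)
        ultimately show "A \<in> (\<lambda>c. extend c +o boundaries (G t) k) ` cycles (F t) k" by blast
      qed
    qed
    show "extend (x + y) +o boundaries (G t) k =
        pv_add ?W t (extend x +o boundaries (G t) k) (extend y +o boundaries (G t) k)" for t and x y :: "'a list \<Rightarrow> 'k"
      by (simp add: quotient_pv_def G.coset_add extend_add)
    show "extend (fscale r x) +o boundaries (G t) k =
        pv_smult ?W t r (extend x +o boundaries (G t) k)" for t r and x :: "'a list \<Rightarrow> 'k"
      by (simp add: quotient_pv_def G.coset_scale extend_scale)
    show "extend x +o boundaries (G t) k = pv_map ?W s t (extend x +o boundaries (G s) k)"
      if "s \<le> t" for s t and x :: "'a list \<Rightarrow> 'k"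
      by (simp add: quotient_pv_def G.coset_map[OF that])
    show "extend x +o boundaries (G t) k = extend y +o boundaries (G t) k \<longleftrightarrow> x - y \<in> boundaries (F t) k"
      if xy: "x \<in> cycles (F t) k" "y \<in> cycles (F t) k" for t and x y :: "'a list \<Rightarrow> 'k"
      unfolding G.coset_eq_iff extend_diff[symmetric]
    proof
      assume "x - y \<in> boundaries (F t) k"
      then obtain b where "b \<in> chains (F t) (Suc k)" "x - y = boundary {X} b"
        unfolding vF by blast
      then show "extend (x - y) \<in> boundaries (G t) k"
        unfolding vG using ext by (auto simp flip: boundary_extend)
    next
      assume "extend (x - y) \<in> boundaries (G t) k"
      then obtain d where d: "d \<in> chains (G t) (Suc k)" "boundary {V} d = extend (x - y)"
        unfolding vG by auto
      \<comment> \<open>Here \<open>d\<close> need not be a cycle: its boundary is supported on the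
        section, which suffices to push \<open>d\<close> itself there.\<close>
      then obtain c e where ce: "c \<in> chains (F t) (Suc k)" "e \<in> chains (G t) (Suc (Suc k))"
          "d = extend c + boundary {V} e"
        using push by blast
      have "extend (x - y) = extend (boundary {X} c)"
        using d(2) boundary_boundary[OF ce(2) finite_V] unfolding ce(3)
        by (simp add: boundary_add boundary_extend)
      moreover have "x - y \<in> chains (F t) k"
        using xy fs.subspace_diff[OF subspace_chains] by (auto simp: vF)
      moreover have "boundary {X} c \<in> chains (F t) k"
        by (rule boundary_in_chains[OF ce(1) F(2)])
      ultimately have "x - y = boundary {X} c"
        by (intro extend_inject[OF _ _ F(1)]) auto
      then show "x - y \<in> boundaries (F t) k" unfolding vF using ce(1) by blast
    qed
  qed
  then show ?thesis by (simp add: persistent_homology_quotient G_def)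
qed

end

section \<open>Rips complexes\<close>

lemma in_rips_iff:
  assumes "finite V"
  shows "\<sigma> \<in> rips V w t \<longleftrightarrow> \<sigma> \<subseteq> V \<and> \<sigma> \<noteq> {} \<and> (\<forall>x\<in>\<sigma>. \<forall>y\<in>\<sigma>. w x y \<le> t)"
proof (cases "\<sigma> \<subseteq> V \<and> \<sigma> \<noteq> {}")
  case True
  then have "finite (\<sigma> \<times> \<sigma>)" "\<sigma> \<times> \<sigma> \<noteq> {}"
    using assms finite_subset by blast+
  then show ?thesis using True by (auto simp: rips_def)
qed (auto simp: rips_def)

lemma rips_mono: "finite V \<Longrightarrow> s \<le> t \<Longrightarrow> rips V w s \<subseteq> rips V w t"
  by (force simp: in_rips_iff)

lemma Union_rips: "\<Union>(rips V w t) \<subseteq> V"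
  by (auto simp: rips_def)

lemma face_closed_rips:
  assumes "finite V"
  shows "face_closed (rips V w t)"
  unfolding face_closed_def in_rips_iff[OF assms] Ball_def by (meson subset_iff)

text \<open>Only finitely many weights occur, so no simplex appears just after
  \<open>s\<close>.\<close>

lemma rips_right_constant:
  assumes "finite V"
  shows "\<exists>t>s. rips V w t = rips V w s"
proof -
  \<comment> \<open>The weights above \<open>s\<close>; the extra element \<open>s + 1\<close>
    ensures that there is a minimum.\<close>
  define T where "T = insert (s + 1) {r \<in> (\<lambda>(x, y). w x y) ` (V \<times> V). s < r}"
  have T: "finite T" "T \<noteq> {}" "\<And>r. r \<in> T \<Longrightarrow> s < r"
    using assms by (auto simp: T_def)
  obtain t where t: "s < t" "t < Min T"
    using dense[of s "Min T"] T by auto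
  have iff: "w x y \<le> t \<longleftrightarrow> w x y \<le> s" if "x \<in> V" "y \<in> V" for x y
  proof
    assume "w x y \<le> t"
    then have "w x y \<notin> T" using t(2) Min_le[OF T(1), of "w x y"] by linarith
    then show "w x y \<le> s" using that by (force simp: T_def)
  qed (use t in simp)
  have "\<sigma> \<in> rips V w t \<longleftrightarrow> \<sigma> \<in> rips V w s" for \<sigma>
    unfolding in_rips_iff[OF assms] using iff by (auto simp: subset_iff)
  then show ?thesis using t(1) by blast
qed

lemma persistent_subspaces_rips:
  assumes "finite V"
  shows "persistent_subspaces (\<lambda>t. cycles (rips V w t) k) (\<lambda>t. boundaries (rips V w t) k :: ('a list \<Rightarrow> 'k::field) set)"
  by (rule persistent_subspaces_homology[OF assms Union_rips face_closed_rips[OF assms] rips_mono[OF assms]])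

lemma rips_diagram_quotient:
  "rips_diagram TYPE('k::field) k V w =
    diagram (quotient_pv (\<lambda>t. cycles (rips V w t) k) (\<lambda>t. boundaries (rips V w t) k :: ('a list \<Rightarrow> 'k) set))"
  by (simp add: rips_diagram_def persistent_homology_quotient)

text \<open>Without inverted pairs, the Rips complexes for \<open>w\<close> and \<open>w'\<close> together still form a chain.\<close>

lemma exists_common_adapted:
  fixes w w' :: "'a \<Rightarrow> 'a \<Rightarrow> real"
  assumes V: "finite V"
    and mono: "\<And>x y u v. {x, y, u, v} \<subseteq> V \<Longrightarrow> w x y < w u v \<Longrightarrow> w' x y \<le> w' u v"
  shows "\<exists>E :: ('a list \<Rightarrow> 'k::field) set.
    adapted_persistent_subspaces (\<lambda>t. cycles (rips V w t) k) (\<lambda>t. boundaries (rips V w t) k) E \<and>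
    adapted_persistent_subspaces (\<lambda>t. cycles (rips V w' t) k) (\<lambda>t. boundaries (rips V w' t) k) E"
proof -
  \<comment> \<open>The full simplex tops the chain of complexes, and its cycles contain all the
    other cycles and all boundaries.\<close>
  define full where "full = Pow V - {{}}"
  define \<K> where "\<K> = insert full (range (rips V w) \<union> range (rips V w'))"
  have full: "K \<subseteq> full" if "K \<in> \<K>" for K
    using that by (auto simp: \<K>_def full_def rips_def)
  have K_V: "\<Union>K \<subseteq> V" if "K \<in> \<K>" for K
    using full[OF that] by (auto simp: full_def)
  have "face_closed full" unfolding face_closed_def full_def by blast
  then have K_closed: "face_closed K" if "K \<in> \<K>" for K
    using that face_closed_rips[OF V] unfolding \<K>_def by blast
  have "\<K> \<subseteq> Pow full" using full by blast
  then have fin: "finite \<K>"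
    by (rule finite_subset) (use V in \<open>simp add: full_def\<close>)
  have cross: "rips V w s \<subseteq> rips V w' t \<or> rips V w' t \<subseteq> rips V w s" for s t
  proof (rule ccontr)
    assume "\<not> ?thesis"
    then obtain \<sigma> \<tau> where "\<sigma> \<in> rips V w s" "\<sigma> \<notin> rips V w' t" "\<tau> \<in> rips V w' t" "\<tau> \<notin> rips V w s"
      by blast
    then have st: "\<sigma> \<subseteq> V" "\<tau> \<subseteq> V" "\<And>x y. x \<in> \<sigma> \<Longrightarrow> y \<in> \<sigma> \<Longrightarrow> w x y \<le> s"
        "\<And>x y. x \<in> \<tau> \<Longrightarrow> y \<in> \<tau> \<Longrightarrow> w' x y \<le> t"
        "\<exists>x\<in>\<sigma>. \<exists>y\<in>\<sigma>. \<not> w' x y \<le> t" "\<exists>x\<in>\<tau>. \<exists>y\<in>\<tau>. \<not> w x y \<le> s"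
      unfolding in_rips_iff[OF V] by blast+
    obtain x y where xy: "x \<in> \<sigma>" "y \<in> \<sigma>" "\<not> w' x y \<le> t" using st(5) by blast
    obtain u v where uv: "u \<in> \<tau>" "v \<in> \<tau>" "\<not> w u v \<le> s" using st(6) by blast
    have "w x y < w u v" "w' u v < w' x y"
      using st(3)[OF xy(1,2)] st(4)[OF uv(1,2)] xy(3) uv(3) by linarith+
    moreover have "{x, y, u, v} \<subseteq> V" using xy uv st(1,2) by blast
    ultimately show False using mono[of x y u v] by simp
  qed
  have linear: "rips V f s \<subseteq> rips V f t \<or> rips V f t \<subseteq> rips V f s" for f :: "'a \<Rightarrow> 'a \<Rightarrow> real" and s t
    using rips_mono[OF V, of s t f] rips_mono[OF V, of t s f] by linarith
  have chain: "K \<subseteq> L \<or> L \<subseteq> K" if KL: "K \<in> \<K>" "L \<in> \<K>" for K L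
  proof (cases "K = full \<or> L = full")
    case True
    then show ?thesis using full KL by blast
  next
    case False
    then have "K \<in> range (rips V w) \<union> range (rips V w')" "L \<in> range (rips V w) \<union> range (rips V w')"
      using KL unfolding \<K>_def by blast+
    then show ?thesis using cross linear by blast
  qed
  let ?Z = "\<lambda>K. cycles K k :: ('a list \<Rightarrow> 'k) set" and ?B = "\<lambda>K. boundaries K k :: ('a list \<Rightarrow> 'k) set"
  have full_in: "full \<in> \<K>" by (simp add: \<K>_def)
  have Z_mono: "?Z K \<subseteq> ?Z L" if "K \<subseteq> L" "L \<in> \<K>" for K L
    by (rule cycles_mono[OF that(1) K_V[OF that(2)] V])
  have B_mono: "?B K \<subseteq> ?B L" if "K \<subseteq> L" "L \<in> \<K>" for K L
    by (rule boundaries_mono[OF that(1) K_V[OF that(2)] V])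
  have B_full: "?B K \<subseteq> ?Z full" if "K \<in> \<K>" for K
    using boundaries_subset_cycles[OF K_V[OF that] V K_closed[OF that]] Z_mono[OF full[OF that] full_in] by blast
  have Z_chain: "?Z K \<subseteq> ?Z L \<or> ?Z L \<subseteq> ?Z K" if "K \<in> \<K>" "L \<in> \<K>" for K L
    using chain[OF that] Z_mono[OF _ that(1), of L] Z_mono[OF _ that(2), of K] by argo
  have B_chain: "?B K \<subseteq> ?B L \<or> ?B L \<subseteq> ?B K" if "K \<in> \<K>" "L \<in> \<K>" for K L
    using chain[OF that] B_mono[OF _ that(1), of L] B_mono[OF _ that(2), of K] by argo
  \<comment> \<open>One flag consists of all cycles, the other of all boundaries with
    \<open>?Z full\<close> as top. Intersecting a member of either flag with \<open>?Z full\<close>,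
    a member of both, gives adaptedness to that member alone.\<close>
  have "\<exists>E. fs.independent E \<and> E \<subseteq> \<Union>(?Z ` \<K>) \<and>
    (\<forall>A\<in>?Z ` \<K>. \<forall>B\<in>insert (?Z full) (?B ` \<K>). A \<inter> B \<subseteq> fs.span (E \<inter> A \<inter> B))"
  proof (rule fs.common_adapted_independent)
    show "finite (?Z ` \<K>)" "finite (insert (?Z full) (?B ` \<K>))" using fin by simp_all
    show "chain_subset (?Z ` \<K>)"
      unfolding chain_subset_def using Z_chain by simp
    show "chain_subset (insert (?Z full) (?B ` \<K>))"
      unfolding chain_subset_def using B_chain B_full by simp
    show "fs.subspace A" if "A \<in> ?Z ` \<K>" for A
      using that subspace_cycles[OF K_V V] by blast
    show "fs.subspace B" if "B \<in> insert (?Z full) (?B ` \<K>)" for B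
      using that subspace_cycles[OF K_V[OF full_in] V] subspace_boundaries[OF K_V V] by blast
  qed
  then obtain E where E: "fs.independent E" "E \<subseteq> \<Union>(?Z ` \<K>)"
      and adapted: "\<forall>A\<in>?Z ` \<K>. \<forall>B\<in>insert (?Z full) (?B ` \<K>). A \<inter> B \<subseteq> fs.span (E \<inter> A \<inter> B)"
    by (elim exE conjE)
  have Int: "?Z K \<inter> B \<subseteq> fs.span (E \<inter> ?Z K \<inter> B)"
    if "K \<in> \<K>" "B \<in> insert (?Z full) (?B ` \<K>)" for K B
    by (rule bspec[OF bspec[OF adapted imageI[OF that(1)]] that(2)])
  \<comment> \<open>An independent set inside the span of finitely many unit functions is
    finite.\<close>
  have "E \<subseteq> ?Z full" using E(2) Z_mono[OF full full_in] by blast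
  also have "\<dots> \<subseteq> chains full k" by (auto simp: cycles_def)
  also have "\<dots> \<subseteq> fs.span (unit_fun ` {xs. set xs \<subseteq> V \<and> length xs = Suc k})"
    by (rule chains_subset_span[OF K_V[OF full_in] V])
  finally have fin_E: "finite E"
    using fs.independent_span_bound[OF _ E(1)] finite_lists_length_eq[OF V] by blast
  have ZE: "?Z K \<subseteq> fs.span (E \<inter> ?Z K)" if "K \<in> \<K>" for K
  proof -
    have "?Z K = ?Z K \<inter> ?Z full" using Z_mono[OF full[OF that] full_in] by blast
    also have "\<dots> \<subseteq> fs.span (E \<inter> ?Z K \<inter> ?Z full)" by (rule Int[OF that insertI1])
    also have "\<dots> \<subseteq> fs.span (E \<inter> ?Z K)" by (intro fs.span_mono) blast
    finally show ?thesis .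
  qed
  have BE: "?B K \<subseteq> fs.span (E \<inter> ?B K)" if "K \<in> \<K>" for K
  proof -
    have "?B K = ?Z full \<inter> ?B K" using B_full[OF that] by blast
    also have "\<dots> \<subseteq> fs.span (E \<inter> ?Z full \<inter> ?B K)" by (rule Int[OF full_in insertI2[OF imageI[OF that]]])
    also have "\<dots> \<subseteq> fs.span (E \<inter> ?B K)" by (intro fs.span_mono) blast
    finally show ?thesis .
  qed
  have "adapted_persistent_subspaces (\<lambda>t. ?Z (rips V f t)) (\<lambda>t. ?B (rips V f t)) E"
    if f: "range (rips V f) \<subseteq> \<K>" for f
  proof (intro adapted_persistent_subspaces.intro persistent_subspaces_rips[OF V]
      adapted_persistent_subspaces_axioms.intro fin_E E(1))
    have in_K: "rips V f t \<in> \<K>" for t using f by blast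
    show "?Z (rips V f t) \<subseteq> fs.span (E \<inter> ?Z (rips V f t))" for t by (rule ZE[OF in_K])
    show "?B (rips V f t) \<subseteq> fs.span (E \<inter> ?B (rips V f t))" for t by (rule BE[OF in_K])
    show "\<exists>t>s. ?Z (rips V f t) = ?Z (rips V f s)" "\<exists>t>s. ?B (rips V f t) = ?B (rips V f s)" for s
      using rips_right_constant[OF V, of s f] by metis+
  qed
  then have "adapted_persistent_subspaces (\<lambda>t. ?Z (rips V w t)) (\<lambda>t. ?B (rips V w t)) E"
    "adapted_persistent_subspaces (\<lambda>t. ?Z (rips V w' t)) (\<lambda>t. ?B (rips V w' t)) E"
    unfolding \<K>_def by blast+
  then show ?thesis by blast
qed

text \<open>Comparing \<open>w\<close> with itself, where no pair is inverted, supplies an adapted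
  basis and with it the explicit diagram.\<close>

lemma rips_diagram_off_diagonal:
  assumes "finite V" "p \<in># rips_diagram TYPE('k::field) k V w"
  shows "fst p < snd p"
proof -
  obtain E :: "('a list \<Rightarrow> 'k) set" where
    "adapted_persistent_subspaces (\<lambda>t. cycles (rips V w t) k) (\<lambda>t. boundaries (rips V w t) k) E"
    using exists_common_adapted[OF assms(1), of w w] by fastforce
  then show ?thesis
    using assms(2) adapted_persistent_subspaces.diagram_quotient
    unfolding rips_diagram_quotient by fastforce
qed

section \<open>Stability under a change of weights, and reduction to one vertex set\<close>

lemma rips_close_subset:
  assumes "finite V" "\<And>x y. x \<in> V \<Longrightarrow> y \<in> V \<Longrightarrow> \<bar>w x y - w' x y\<bar> \<le> \<epsilon>"
  shows "rips V w t \<subseteq> rips V w' (t + \<epsilon>)"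
proof
  fix \<sigma> assume \<sigma>: "\<sigma> \<in> rips V w t"
  have "w' x y \<le> t + \<epsilon>" if "x \<in> \<sigma>" "y \<in> \<sigma>" for x y
  proof -
    have "w x y \<le> t" "x \<in> V" "y \<in> V" using \<sigma> that by (auto simp: in_rips_iff[OF assms(1)])
    then show ?thesis using assms(2)[of x y] by linarith
  qed
  then show "\<sigma> \<in> rips V w' (t + \<epsilon>)" using \<sigma> by (simp add: in_rips_iff[OF assms(1)])
qed

text \<open>The interpolation moves a weight as a vector indexed by \<open>V \<times> V\<close>,
  hence the currying; inverted pairs are pairs of such indices.\<close>

lemma rips_diagram_close:
  fixes w w' :: "'a \<Rightarrow> 'a \<Rightarrow> real"
  assumes V: "finite V" and \<epsilon>: "0 \<le> \<epsilon>" "\<And>x y. x \<in> V \<Longrightarrow> y \<in> V \<Longrightarrow> \<bar>w x y - w' x y\<bar> \<le> \<epsilon>"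
  shows "bottleneck_close \<epsilon> (rips_diagram TYPE('k::field) k V w) (rips_diagram TYPE('k) k V w')"
proof -
  let ?P = "\<lambda>\<epsilon> f f'. bottleneck_close \<epsilon> (rips_diagram TYPE('k) k V (curry f)) (rips_diagram TYPE('k) k V (curry f'))"
  have "?P \<epsilon> (case_prod w) (case_prod w')"
  proof (rule interpolation_induct[where U = "V \<times> V" and P = ?P])
    show "finite (V \<times> V)" using V by simp
    show "0 \<le> \<epsilon>" by (rule \<epsilon>(1))
    show "\<bar>case_prod w u - case_prod w' u\<bar> \<le> \<epsilon>" if "u \<in> V \<times> V" for u
      using that \<epsilon>(2) by auto
    show "?P (\<epsilon> + \<delta>) f f''" if "0 \<le> \<epsilon>" "0 \<le> \<delta>" "?P \<epsilon> f f'" "?P \<delta> f' f''" for \<epsilon> \<delta> f f' f''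
      by (rule bottleneck_close_trans[OF that(3,4,1,2)])
    fix f f' :: "'a \<times> 'a \<Rightarrow> real" and \<epsilon> :: real
    assume \<epsilon>: "0 \<le> \<epsilon>" and diff: "\<And>u. u \<in> V \<times> V \<Longrightarrow> \<bar>f u - f' u\<bar> \<le> \<epsilon>"
      and mono: "\<And>u v. u \<in> V \<times> V \<Longrightarrow> v \<in> V \<times> V \<Longrightarrow> f u < f v \<Longrightarrow> f' u \<le> f' v"
    let ?Z = "\<lambda>f t. cycles (rips V (curry f) t) k :: ('a list \<Rightarrow> 'k) set"
      and ?B = "\<lambda>f t. boundaries (rips V (curry f) t) k :: ('a list \<Rightarrow> 'k) set"
    obtain E where E: "adapted_persistent_subspaces (?Z f) (?B f) E"
        "adapted_persistent_subspaces (?Z f') (?B f') E"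
      using exists_common_adapted[OF V, of "curry f" "curry f'" k, where 'k = 'k] mono by auto
    have sub: "rips V (curry f) t \<subseteq> rips V (curry f') (t + \<epsilon>)"
        "rips V (curry f') t \<subseteq> rips V (curry f) (t + \<epsilon>)" for t
      using diff by (auto intro!: rips_close_subset[OF V, THEN subsetD] simp: abs_minus_commute)
    show "?P \<epsilon> f f'"
      unfolding rips_diagram_quotient
      by (rule bottleneck_close_adapted[OF E cycles_mono[OF sub(1) Union_rips V] cycles_mono[OF sub(2) Union_rips V]
            boundaries_mono[OF sub(1) Union_rips V] boundaries_mono[OF sub(2) Union_rips V] \<epsilon>])
  qed
  then show ?thesis by simp
qed

text \<open>The weights on a simplex of \<open>R\<close> are those on its image, so the Rips
  complexes of the pulled-back weight are the pullback complexes.\<close>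

lemma rips_diagram_pullback:
  fixes w :: "'a \<Rightarrow> 'a \<Rightarrow> real" and p :: "'b \<Rightarrow> 'a"
  assumes R: "finite R" and p: "p ` R = X"
  shows "rips_diagram TYPE('k::field) k R (\<lambda>u v. w (p u) (p v)) = rips_diagram TYPE('k) k X w"
proof -
  define s where "s = inv_into R p"
  interpret vertex_section X R p s
  proof
    show "s ` X \<subseteq> R" unfolding s_def p[symmetric] by (rule image_subsetI) (rule inv_into_into)
    show "p (s x) = x" if "x \<in> X" for x unfolding s_def using that p by (simp add: f_inv_into_f)
  qed (use R p in auto)
  have eq: "pullback_complex p R (rips X w t) = rips R (\<lambda>u v. w (p u) (p v)) t" for t
  proof (rule set_eqI)
    fix \<sigma>
    have "\<sigma> \<subseteq> R \<Longrightarrow> p ` \<sigma> \<subseteq> X" using p by blast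
    then show "\<sigma> \<in> pullback_complex p R (rips X w t) \<longleftrightarrow> \<sigma> \<in> rips R (\<lambda>u v. w (p u) (p v)) t"
      by (auto simp: pullback_complex_def in_rips_iff[OF R] in_rips_iff[OF finite_X])
  qed
  interpret persistent_subspaces "\<lambda>t. cycles (rips X w t) k" "\<lambda>t. boundaries (rips X w t) k :: ('a list \<Rightarrow> 'k) set"
    by (rule persistent_subspaces_rips[OF finite_X])
  have "pv_isomorphic (persistent_homology (rips X w) k :: ('k, ('a list \<Rightarrow> 'k) set) persistence_vs)
    (persistent_homology (\<lambda>t. pullback_complex p R (rips X w t)) k :: ('k, ('b list \<Rightarrow> 'k) set) persistence_vs)"
    by (rule pullback_isomorphic[OF Union_rips face_closed_rips[OF finite_X] rips_mono[OF finite_X]])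
  from diagram_cong[OF this] show ?thesis
    unfolding eq rips_diagram_def by (simp add: persistent_homology_quotient pv_closed_quotient)
qed

theorem proposition12:
  fixes X :: "'a set" and wX :: "'a \<Rightarrow> 'a \<Rightarrow> real"
    and Y :: "'b set" and wY :: "'b \<Rightarrow> 'b \<Rightarrow> real"
    and k :: nat
  assumes "network X wX" and "network Y wY"
  shows "bottleneck_dist (rips_diagram TYPE('k::field) k X wX) (rips_diagram TYPE('k) k Y wY)
    \<le> ereal (2 * network_dist X wX Y wY)"
proof -
  have fin: "finite X" "finite Y" and ne: "X \<noteq> {}" "Y \<noteq> {}"
    using assms by (auto simp: network_def)
  \<comment> \<open>There are finitely many correspondences and at least
    \<open>X \<times> Y\<close>, so the minimum is attained.\<close>
  have "{R. correspondence X Y R} \<subseteq> Pow (X \<times> Y)" by (auto simp: correspondence_def)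
  then have "finite {R. correspondence X Y R}" by (rule finite_subset) (use fin in simp)
  moreover have "correspondence X Y (X \<times> Y)" using ne by (auto simp: correspondence_def)
  ultimately have "Min (distortion wX wY ` {R. correspondence X Y R}) \<in> distortion wX wY ` {R. correspondence X Y R}"
    by (intro Min_in) auto
  then obtain R where R: "correspondence X Y R" "distortion wX wY R = 2 * network_dist X wX Y wY"
    by (auto simp: network_dist_def)
  then have R_sub: "R \<subseteq> X \<times> Y" "fst ` R = X" "snd ` R = Y" by (simp_all add: correspondence_def)
  then have R_fin: "finite R" "R \<noteq> {}" using fin ne finite_subset by fastforce+
  have dist: "\<bar>wX (fst u) (fst v) - wY (snd u) (snd v)\<bar> \<le> distortion wX wY R" if "u \<in> R" "v \<in> R" for u v
    unfolding distortion_def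
  proof (rule Max_ge)
    show "finite ((\<lambda>((x, y), (x', y')). \<bar>wX x x' - wY y y'\<bar>) ` (R \<times> R))" using R_fin by simp
    show "\<bar>wX (fst u) (fst v) - wY (snd u) (snd v)\<bar> \<in> (\<lambda>((x, y), (x', y')). \<bar>wX x x' - wY y y'\<bar>) ` (R \<times> R)"
      by (rule image_eqI[of _ _ "(u, v)"]) (use that in \<open>auto split: prod.split\<close>)
  qed
  have pos: "0 \<le> distortion wX wY R"
  proof -
    obtain u where "u \<in> R" using R_fin by blast
    then show ?thesis using dist[of u u] by linarith
  qed
  have "bottleneck_close (distortion wX wY R)
      (rips_diagram TYPE('k) k R (\<lambda>u v. wX (fst u) (fst v))) (rips_diagram TYPE('k) k R (\<lambda>u v. wY (snd u) (snd v)))"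
    by (rule rips_diagram_close[OF R_fin(1) pos dist])
  \<comment> \<open>Both coordinate projections of \<open>R\<close> are onto, so the diagrams of the
    two pulled-back weights are those of \<open>X\<close> and \<open>Y\<close>.\<close>
  then have "bottleneck_close (distortion wX wY R) (rips_diagram TYPE('k) k X wX) (rips_diagram TYPE('k) k Y wY)"
    unfolding rips_diagram_pullback[OF R_fin(1) R_sub(2)] rips_diagram_pullback[OF R_fin(1) R_sub(3)] .
  then show ?thesis
    unfolding R(2)[symmetric]
    by (rule bottleneck_dist_le[OF _ pos])
      (erule rips_diagram_off_diagonal[OF fin(1)], erule rips_diagram_off_diagonal[OF fin(2)])
qed

end
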